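(* Let $O=\{(x_1,x_2,x_3)\in\mathbb{E}^3:\ |x_1|+|x_2|+|x_3|\le 1\}$ be the regular octahedron. Then $$\gamma^{*}(O)=\tfrac{7}{6},$$ that is, $7/6$ is the smallest positive number $r$ such that there exists a lattice $\Lambda\subset\mathbb{E}^3$ for which $O+\Lambda$ is a packing of $\mathbb{E}^3$ and $rO+\Lambda$ is a covering of $\mathbb{E}^3$.
   Context: For a centrally symmetric convex body $C$ centered at the origin of $\mathbb{E}^n$, the simultaneous lattice packing-covering constant is $\gamma^*(C)=\min_\Lambda\{r>0:\ rC+\Lambda \text{ is a covering of } \mathbb{E}^n\}$, where the minimum is over all lattices $\Lambda$ such that $C+\Lambda$ is a packing (translates have pairwise disjoint interiors). $A+B$ denotes the Minkowski sum. *)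

theory Defs
  imports "HOL-Analysis.Analysis" "HOL-Library.Set_Algebras"
begin

(* Full-rank lattices: the integer combinations of a vector space basis. *)
definition is_lattice :: "'a::euclidean_space set \<Rightarrow> bool" where
  "is_lattice L \<longleftrightarrow>
     (\<exists>B. independent B \<and> span B = UNIV \<and>
          L = range (\<lambda>c :: 'a \<Rightarrow> int. \<Sum>b\<in>B. of_int (c b) *\<^sub>R b))"

definition is_packing :: "'a::euclidean_space set \<Rightarrow> 'a set \<Rightarrow> bool" where
  "is_packing C X \<longleftrightarrow>
     (\<forall>u\<in>X. \<forall>v\<in>X. u \<noteq> v \<longrightarrow> interior ((+) u ` C) \<inter> interior ((+) v ` C) = {})"

(* Here + is the Minkowski sum of sets. *)
definition is_covering :: "'a::euclidean_space set \<Rightarrow> 'a set \<Rightarrow> bool" where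
  "is_covering C X \<longleftrightarrow> C + X = UNIV"

(* LEAST is meaningful only if the minimum is attained; otherwise the value is unspecified. *)
definition gamma_star :: "'a::euclidean_space set \<Rightarrow> real" where
  "gamma_star C =
     (LEAST r. r > 0 \<and>
        (\<exists>L. is_lattice L \<and> is_packing C L \<and> is_covering ((*\<^sub>R) r ` C) L))"

definition octahedron :: "(real ^ 3) set" where
  "octahedron = {x. \<bar>x $ 1\<bar> + \<bar>x $ 2\<bar> + \<bar>x $ 3\<bar> \<le> 1}"

end

theory Submission
  imports Defs
begin

text \<open>
  Lower bound. Suppose that the translates of the octahedron form a packing and that the covering
  radius is less than \<open>7/6\<close>. For each of the four pairs of opposite facets, the point \<open>7/6\<close> times
  the facet centre is close to a lattice vector, which the packing condition forces to lie just
  beyond that facet. These four vectors \<open>d\<^sub>0, \<dots>, d\<^sub>3\<close> are dependent modulo \<open>2L\<close>, so some nonempty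
  partial sum of them equals \<open>2h\<close> with \<open>h \<in> L\<close>. In each case \<open>h\<close> is so short that the packing
  condition leaves only a few explicit linear relations between the \<open>d\<^sub>i\<close>. Each is refuted by
  exhibiting holes: at a suitable point, given by an affine expression in the coordinates of the
  \<open>d\<^sub>i\<close>, every lattice vector within distance \<open>7/6\<close> would yield a nonzero lattice vector of norm
  less than \<open>2\<close>.

  Upper bound. The lattice spanned by \<open>(3, -2, 1)/3\<close>, \<open>(1, 3, -2)/3\<close>, \<open>(-2, 1, 3)/3\<close> is
  \<open>1/3\<close> times the set of integer points with \<open>38 dvd X + 7 Y + 11 Z\<close>.
\<close>

section \<open>Packing and covering by octahedra in terms of the \<open>l\<^sub>1\<close> norm\<close>

text \<open>The four pairs of opposite facets are interchangeable, so the lower bound is carried out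
  in the values of the four facet functionals. They sum to zero and may be permuted, and all
  hypotheses become linear inequalities in them. The origin of 7/6: most holes are placed at one
  common depth m from four lattice vectors, each measured across a different facet. Since the four
  values of any point sum to 0, 4m is a combination of facet values of these vectors. In the
  tightest configurations it is a sum of three terms. Two of them are at least 2 by packing; the
  third is at least 2/3, because the least of three values with sum at most -2 is at most -2/3.
  Hence m \<ge> (2 + 2 + 2/3)/4 = 7/6. So the four reference vectors do not cover the hole, and the
  long case splits only exclude all other lattice vectors. Ordering hypotheses serve to single out
  that least value. On the other side, 7/6 becomes 7/2 after scaling by 3, and only six of the 38
  classes of unit cubes use this bound in full.\<close>

definition l1 :: "real ^ 3 \<Rightarrow> real" where
  "l1 x = \<bar>x $ 1\<bar> + \<bar>x $ 2\<bar> + \<bar>x $ 3\<bar>"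

lemma l1_scale: "l1 (t *\<^sub>R x) = \<bar>t\<bar> * l1 x"
  by (simp add: l1_def abs_mult algebra_simps)

lemma l1_minus_commute: "l1 (x - y) = l1 (y - x)"
  by (simp add: l1_def abs_minus_commute)

lemma l1_triangle: "l1 (x + y) \<le> l1 x + l1 y"
  by (simp add: l1_def)

lemma l1_eq_0: "l1 x = 0 \<longleftrightarrow> x = 0"
  by (auto simp: l1_def vec_eq_iff forall_3)

lemma translate_octahedron: "(+) u ` octahedron = {x. l1 (x - u) \<le> 1}"
proof (intro equalityI subsetI)
  fix x assume "x \<in> {x. l1 (x - u) \<le> 1}"
  then show "x \<in> (+) u ` octahedron"
    by (intro image_eqI[of _ _ "x - u"]) (auto simp: octahedron_def l1_def)
qed (auto simp: octahedron_def l1_def)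

lemma interior_translate_octahedron: "interior ((+) u ` octahedron) = {x. l1 (x - u) < 1}"
proof (intro equalityI subsetI)
  fix x assume "x \<in> interior ((+) u ` octahedron)"
  then obtain e where e: "e > 0" "cball x e \<subseteq> (+) u ` octahedron"
    using mem_interior_cball by blast
  show "x \<in> {x. l1 (x - u) < 1}"
  proof (cases "x = u")
    case False
    \<comment> \<open>Pushing \<open>x\<close> away from \<open>u\<close> by the factor 1 + t moves
      it by exactly \<open>e\<close>, so it stays in the translate; hence the norm of
      \<open>x - u\<close> is at most 1/(1 + t), which is less than 1.\<close>
    define t where "t = e / norm (x - u)"
    have t: "t > 0" using False e by (simp add: t_def)
    have "x + t *\<^sub>R (x - u) \<in> cball x e"
      using False e by (simp add: dist_norm t_def)
    with e have "l1 (x + t *\<^sub>R (x - u) - u) \<le> 1"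
      by (auto simp: translate_octahedron)
    moreover have "x + t *\<^sub>R (x - u) - u = (1 + t) *\<^sub>R (x - u)"
      by (simp add: algebra_simps)
    ultimately have le: "(1 + t) * l1 (x - u) \<le> 1"
      using t by (simp add: l1_scale)
    have "l1 (x - u) > 0"
      using False l1_eq_0[of "x - u"] by (simp add: l1_def)
    with t have "t * l1 (x - u) > 0" by simp
    with le show ?thesis by (simp add: algebra_simps)
  qed (simp add: l1_def)
next
  have "open {x. l1 (x - u) < 1}"
    unfolding l1_def by (intro open_Collect_less continuous_intros)
  then show "x \<in> interior ((+) u ` octahedron)" if "x \<in> {x. l1 (x - u) < 1}" for x
    using that by (intro interiorI[of "{x. l1 (x - u) < 1}"]) (auto simp: translate_octahedron)
qed

lemma packing_octahedron_iff:
  "is_packing octahedron X \<longleftrightarrow> (\<forall>u\<in>X. \<forall>v\<in>X. u \<noteq> v \<longrightarrow> 2 \<le> l1 (u - v))"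
proof -
  have "{x. l1 (x - u) < 1} \<inter> {x. l1 (x - v) < 1} = {} \<longleftrightarrow> 2 \<le> l1 (u - v)" for u v
  proof
    assume *: "{x. l1 (x - u) < 1} \<inter> {x. l1 (x - v) < 1} = {}"
    define m where "m = (1/2) *\<^sub>R (u + v)"
    have "m - u = (1/2) *\<^sub>R (v - u)" "m - v = (1/2) *\<^sub>R (u - v)"
      by (simp_all add: m_def vec_eq_iff field_simps)
    then have "l1 (m - u) = l1 (u - v) / 2" "l1 (m - v) = l1 (u - v) / 2"
      by (simp_all add: l1_scale l1_minus_commute[of v u])
    moreover have "\<not> (l1 (m - u) < 1 \<and> l1 (m - v) < 1)"
      using * by blast
    ultimately show "2 \<le> l1 (u - v)"
      by simp
  next
    assume "2 \<le> l1 (u - v)"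
    moreover have "l1 (u - v) \<le> l1 (x - u) + l1 (x - v)" for x
      using l1_triangle[of "u - x" "x - v"] by (simp add: l1_minus_commute[of u])
    ultimately show "{x. l1 (x - u) < 1} \<inter> {x. l1 (x - v) < 1} = {}"
      by (smt (verit) disjoint_iff mem_Collect_eq)
  qed
  then show ?thesis
    by (simp add: is_packing_def interior_translate_octahedron)
qed

lemma covering_octahedron_iff:
  assumes "0 < r"
  shows "is_covering ((*\<^sub>R) r ` octahedron) X \<longleftrightarrow> (\<forall>p. \<exists>v\<in>X. l1 (p - v) \<le> r)"
proof -
  have eq: "(*\<^sub>R) r ` octahedron = {x. l1 x \<le> r}"
  proof (intro equalityI subsetI)
    fix x assume "x \<in> {x. l1 x \<le> r}"
    then have "(1 / r) *\<^sub>R x \<in> octahedron"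
      using assms l1_scale[of "1 / r" x] by (simp add: octahedron_def l1_def)
    then show "x \<in> (*\<^sub>R) r ` octahedron"
      using assms by (intro image_eqI[of _ _ "(1 / r) *\<^sub>R x"]) auto
  next
    fix x assume "x \<in> (*\<^sub>R) r ` octahedron"
    then obtain y where "x = r *\<^sub>R y" "l1 y \<le> 1" by (auto simp: octahedron_def l1_def)
    then show "x \<in> {x. l1 x \<le> r}"
      using assms by (simp add: l1_scale mult_left_le)
  qed
  have "p \<in> {x. l1 x \<le> r} + X \<longleftrightarrow> (\<exists>v\<in>X. l1 (p - v) \<le> r)" for p
  proof
    assume "\<exists>v\<in>X. l1 (p - v) \<le> r"
    then show "p \<in> {x. l1 x \<le> r} + X"
      by (metis diff_add_cancel mem_Collect_eq set_plus_intro)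
  next
    assume "p \<in> {x. l1 x \<le> r} + X"
    then obtain x v where "p = x + v" "l1 x \<le> r" "v \<in> X"
      by (auto simp: set_plus_def)
    then show "\<exists>v\<in>X. l1 (p - v) \<le> r"
      by (intro bexI[of _ v]) simp_all
  qed
  then show ?thesis
    unfolding is_covering_def eq by blast
qed

lemma lattice_coordinates:
  fixes L :: "(real ^ 3) set"
  assumes "is_lattice L"
  obtains x y z where "L = {of_int i *\<^sub>R x + of_int j *\<^sub>R y + of_int k *\<^sub>R z | i j k. True}"
proof -
  obtain B where B: "independent B" "span B = UNIV"
    and L: "L = range (\<lambda>c. \<Sum>b\<in>B. of_int (c b) *\<^sub>R b)"
    using assms unfolding is_lattice_def by blast
  have "card B = 3"
    using B dim_eq_card_independent[OF B(1)] dim_span[of B] by (simp add: dim_UNIV)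
  then obtain x y z where xyz: "B = {x, y, z}" "x \<noteq> y" "y \<noteq> z" "x \<noteq> z"
    by (auto simp: card_3_iff)
  have "L = {of_int i *\<^sub>R x + of_int j *\<^sub>R y + of_int k *\<^sub>R z | i j k. True}"
  proof (intro equalityI subsetI)
    fix v assume "v \<in> {of_int i *\<^sub>R x + of_int j *\<^sub>R y + of_int k *\<^sub>R z | i j k. True}"
    then obtain i j k where "v = of_int i *\<^sub>R x + of_int j *\<^sub>R y + of_int k *\<^sub>R z" by blast
    then show "v \<in> L"
      unfolding L xyz using xyz(2-4)
      by (intro range_eqI[of _ _ "\<lambda>b. if b = x then i else if b = y then j else k"]) auto
  next
    fix v assume "v \<in> L"
    then obtain c where "v = (\<Sum>b\<in>B. of_int (c b) *\<^sub>R b)" by (auto simp: L)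
    then have "v = of_int (c x) *\<^sub>R x + of_int (c y) *\<^sub>R y + of_int (c z) *\<^sub>R z"
      using xyz by (simp add: add.assoc)
    then show "v \<in> {of_int i *\<^sub>R x + of_int j *\<^sub>R y + of_int k *\<^sub>R z | i j k. True}"
      by blast
  qed
  with that show thesis by blast
qed

section \<open>Lattices of covering radius less than \<open>7/6\<close>\<close>


text \<open>
  A lattice vector within distance \<open>7/6\<close> of \<open>7/6\<close> times the centre of the facet \<open>a = 1\<close> lies in this region.
\<close>

definition cap :: "('a \<Rightarrow> real) \<Rightarrow> ('a \<Rightarrow> real) \<Rightarrow> ('a \<Rightarrow> real) \<Rightarrow> ('a \<Rightarrow> real) \<Rightarrow> 'a \<Rightarrow> bool" where
  "cap a b c d v \<longleftrightarrow> 2 \<le> a v \<and> a v < 7/3 \<and> -14/9 < b v \<and> b v < 7/9 \<and> -14/9 < c v \<and> c v < 7/9 \<and> -14/9 < d v \<and> d v < 7/9"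

lemma capD:
  assumes "cap a b c d v"
  shows "2 \<le> a v" "a v < 7/3" "-14/9 < b v" "b v < 7/9" "-14/9 < c v" "c v < 7/9" "-14/9 < d v" "d v < 7/9"
  using assms by (simp_all add: cap_def)

text \<open>
  \<open>a, b, c, d\<close> stand for the facet functionals \<open>x\<^sub>1 + x\<^sub>2 + x\<^sub>3\<close>, \<open>x\<^sub>1 - x\<^sub>2 - x\<^sub>3\<close>, \<open>- x\<^sub>1 + x\<^sub>2 - x\<^sub>3\<close>,
  \<open>- x\<^sub>1 - x\<^sub>2 + x\<^sub>3\<close>: the \<open>l\<^sub>1\<close> norm is the maximum of their absolute values, and they sum to zero.
  Assumption \<open>halve\<close> says that four vectors of \<open>L\<close> are linearly dependent in \<open>L / 2L\<close>.
\<close>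

locale octahedral =
  fixes L :: "'a::real_vector set" and a b c d :: "'a \<Rightarrow> real"
  assumes linear: "linear a" "linear b" "linear c" "linear d"
    and sum0: "a v + b v + c v + d v = 0"
    and diff: "u \<in> L \<Longrightarrow> v \<in> L \<Longrightarrow> u - v \<in> L"
    and pack: "v \<in> L \<Longrightarrow> \<bar>a v\<bar> < 2 \<Longrightarrow> \<bar>b v\<bar> < 2 \<Longrightarrow> \<bar>c v\<bar> < 2 \<Longrightarrow> \<bar>d v\<bar> < 2 \<Longrightarrow> v = 0"
    and cover: "p + q + r + s = 0 \<Longrightarrow>
      \<exists>v\<in>L. \<bar>p - a v\<bar> < 7/6 \<and> \<bar>q - b v\<bar> < 7/6 \<and> \<bar>r - c v\<bar> < 7/6 \<and> \<bar>s - d v\<bar> < 7/6"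
    and halve: "{t, u, v, w} \<subseteq> L \<Longrightarrow> \<exists>h\<in>L. h + h \<in>
      {t, u, v, w, t + u, t + v, t + w, u + v, u + w, v + w, t + u + v, t + u + w, t + v + w, u + v + w, t + u + v + w}"
begin

lemma lin_simps:
  "a (u + v) = a u + a v" "b (u + v) = b u + b v" "c (u + v) = c u + c v" "d (u + v) = d u + d v"
  "a (u - v) = a u - a v" "b (u - v) = b u - b v" "c (u - v) = c u - c v" "d (u - v) = d u - d v"
  "a (- v) = - a v" "b (- v) = - b v" "c (- v) = - c v" "d (- v) = - d v"
  "a 0 = 0" "b 0 = 0" "c 0 = 0" "d 0 = 0"
  using linear by (simp_all add: linear_add linear_diff linear_neg linear_0)

lemma zeroL: "0 \<in> L"
  using cover[of 0 0 0 0] diff by fastforce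

lemma negL: "v \<in> L \<Longrightarrow> - v \<in> L"
  using diff[OF zeroL] by simp

lemma addL: "u \<in> L \<Longrightarrow> v \<in> L \<Longrightarrow> u + v \<in> L"
  using diff[of u "- v"] negL by simp

lemmas L_closed = zeroL negL addL diff

text \<open>Contrapositive of \<open>pack\<close>, written in coordinates so that all nine
  alternatives are linear. It drives every search below: it is applied to a combination of known
  lattice vectors, most alternatives clash at once with the bounds on the hole, and each survivor
  becomes a hypothesis under which another combination is tested.\<close>

lemma far:
  assumes "v \<in> L"
  shows "a v = 0 \<and> b v = 0 \<and> c v = 0 \<and> d v = 0 \<or>
     2 \<le> a v \<or> a v \<le> -2 \<or> 2 \<le> b v \<or> b v \<le> -2 \<or> 2 \<le> c v \<or> c v \<le> -2 \<or> 2 \<le> d v \<or> d v \<le> -2"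
  using pack[OF assms] lin_simps(13-16) by fastforce

text \<open>A hole is recorded by its four facet values alone, so no point of the abstract space has
  to be exhibited. The inequalities are strict: a lattice vector at depth exactly 7/6 is already too
  far.\<close>

definition near :: "real \<Rightarrow> real \<Rightarrow> real \<Rightarrow> real \<Rightarrow> 'a \<Rightarrow> bool" where
  "near p q r s v \<longleftrightarrow> \<bar>p - a v\<bar> < 7/6 \<and> \<bar>q - b v\<bar> < 7/6 \<and> \<bar>r - c v\<bar> < 7/6 \<and> \<bar>s - d v\<bar> < 7/6"

lemma nearD:
  assumes "near p q r s v"
  shows "p - a v < 7/6" "a v - p < 7/6" "q - b v < 7/6" "b v - q < 7/6"
    "r - c v < 7/6" "c v - r < 7/6" "s - d v < 7/6" "d v - s < 7/6"
  using assms unfolding near_def by linarith+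

lemma cover':
  "p + q + r + s = 0 \<Longrightarrow> \<exists>v. v \<in> L \<and> near p q r s v"
  using cover[of p q r s] by (auto simp: near_def)

section \<open>Refuting the linear relations, with the facets suitably ordered\<close>

text \<open>
  The hole points and case splits in the next five proofs were found by a computer search.
\<close>

lemma cyclic_edges_ordered:
  assumes L: "d0 \<in> L" "d1 \<in> L" "d2 \<in> L" "d3 \<in> L" and rel: "d0 + d1 + d2 + d3 = 0"
    and caps: "cap a b c d d0" "cap b a c d d1" "cap c a b d d2" "cap d a b c d3"
    and edges: "2 \<le> c d1 + c d2" "2 \<le> d d2 + d d3" "2 \<le> b d3 + b d1"
    and sorted: "b d0 \<le> c d0" "b d0 \<le> d d0"
  shows False
proof -
  note C0 = capD[OF caps(1)] and C1 = capD[OF caps(2)] and C2 = capD[OF caps(3)] and C3 = capD[OF caps(4)]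
  have R: "a d0 + a d1 + a d2 + a d3 = 0" "b d0 + b d1 + b d2 + b d3 = 0"
    "c d0 + c d1 + c d2 + c d3 = 0" "d d0 + d d1 + d d2 + d d3 = 0"
    using rel by (metis lin_simps)+
  \<comment> \<open>The coordinates are 0, \<open>b d0\<close>, \<open>- c d2\<close>,
    \<open>d d0 + d d1\<close> plus a common shift m that makes them sum to 0. So the hole has the
    same depth m from the lattice vectors 0, \<open>d0\<close>, \<open>- d2\<close>,
    \<open>d0 + d1\<close>, measured by \<open>a\<close>, \<open>b\<close>, \<open>c\<close>,
    \<open>d\<close> respectively. Here 4m is the sum of \<open>c d2\<close>,
    \<open>d d2 + d d3\<close> and \<open>- b d0\<close>; the ordering and
    \<open>a d0 \<ge> 2\<close> give \<open>b d0 \<le> -2/3\<close>, hence m \<ge> 7/6 and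
    \<open>x\<close> is none of the four.\<close>
  have "\<exists>x. x \<in> L \<and> near (- 1/4 * b d0 + 1/4 * c d2 - 1/4 * d d0 - 1/4 * d d1)
      (3/4 * b d0 + 1/4 * c d2 - 1/4 * d d0 - 1/4 * d d1) (- 3/4 * c d2 - 1/4 * b d0 - 1/4 * d d0 - 1/4 * d d1)
      (3/4 * d d0 + 3/4 * d d1 - 1/4 * b d0 + 1/4 * c d2) x"
    by (rule cover') linarith
  then obtain x where L_x: "x \<in> L" and near_x: "near (- 1/4 * b d0 + 1/4 * c d2 - 1/4 * d d0 - 1/4 * d d1)
      (3/4 * b d0 + 1/4 * c d2 - 1/4 * d d0 - 1/4 * d d1) (- 3/4 * c d2 - 1/4 * b d0 - 1/4 * d d0 - 1/4 * d d1)
      (3/4 * d d0 + 3/4 * d d1 - 1/4 * b d0 + 1/4 * c d2) x" by blast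
  note X = nearD[OF near_x]
  have mem1: "d0 - x \<in> L" by (intro L_closed L L_x)
  have n1: "\<not> 2 \<le> a d0 - a x"
  proof
    assume h1: "2 \<le> a d0 - a x"
    have mem2: "x \<in> L" by (intro L_closed L L_x)
    have n2: "\<not> c x \<le> - 2"
    proof
      assume h2: "c x \<le> - 2"
      have mem3: "d2 + x \<in> L" by (intro L_closed L L_x)
      show False
        using far[OF mem3, unfolded lin_simps]
        by (elim disjE conjE,
            use C2(5) C3(2) sum0[of d0] sum0[of d2] R(4) edges(2) sorted(1,2) X(5) h1 h2 in linarith,
            use C0(2) C2(1,5) C3(2) sum0[of d2] edges(2) h1 in linarith,
            use C2(3) C3(1) sum0[of d2] R(2,4) edges(3) X(1) in linarith,
            use C2(3) C3(2) sum0[of d2] R(2,4) edges(3) X(4) in linarith,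
            use C0(2,3) C2(2,5) R(4) edges(2) X(8) sum0[of x] h1 h2 in linarith, use C2(2) h2 in linarith,
            use C0(1) C2(1) sum0[of d0] R(4) edges(2) sorted(1,2) X(5) in linarith,
            use C0(3) C2(2,8) C3(1) R(4) X(8) in linarith,
            use C0(2) C2(2) C3(2) sum0[of d0] R(4) edges(2) sorted(1,2) X(4) sum0[of x] h1 h2 in linarith)
    qed
    have n3: "\<not> d x \<le> - 2"
    proof
      assume h3: "d x \<le> - 2"
      have mem4: "d1 - x \<in> L" by (intro L_closed L L_x)
      show False
        using far[OF mem4, unfolded lin_simps]
        by (elim disjE conjE, use C1(7) h3 in linarith,
            use C0(1) C1(1,4,7) sum0[of d0] sum0[of d1] R(4) edges(1,2) sorted(1) X(1) in linarith,
            use C0(2) C1(3) h1 in linarith,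
            use C0(2) C1(2,7) C2(1) C3(7) sum0[of d0] R(3) edges(1) X(6) sum0[of x] h1 h3 in linarith,
            use C0(1) C1(1,7) C2(2) sum0[of d0] sorted(1,2) X(4) in linarith,
            use C0(2) C1(6,7) C2(1) C3(7) R(3) sorted(1,2) X(4) sum0[of x] h1 h3 in linarith,
            use C0(2) C1(7) C2(2) C3(7) sum0[of d0] R(3) edges(1) X(6) in linarith,
            use C0(2) C2(1) C3(7) sum0[of d0] R(3) edges(1) sorted(2) X(7) h3 in linarith,
            use C1(7) h3 in linarith)
    qed
    show False
      using far[OF mem2, unfolded lin_simps]
      by (elim disjE conjE, use C2(1) sum0[of d0] R(4) edges(2) sorted(1,2) X(1) sum0[of x] h1 in linarith,
          use C0(2) h1 in linarith, use C0(1) C2(1) sum0[of d0] R(4) edges(2) sorted(1,2) X(1) in linarith,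
          use C1(7) C2(2) sum0[of d0] sorted(1,2) X(1,4) h1 in linarith,
          use C0(3) C2(1) R(4) edges(2) X(3) in linarith,
          use C0(2) C1(7) C2(1) C3(7) sum0[of d0] R(3) edges(1) X(6) in linarith, use n2 in linarith,
          use C0(3) C2(2) R(4) edges(2) X(8) in linarith, use n3 in linarith)
  qed
  have n4: "\<not> b d0 - b x \<le> - 2"
  proof
    assume h4: "b d0 - b x \<le> - 2"
    have mem5: "d0 + d1 - x \<in> L" by (intro L_closed L L_x)
    have n5: "\<not> 2 \<le> a d0 + a d1 - a x"
    proof
      assume h5: "2 \<le> a d0 + a d1 - a x"
      have mem6: "d0 + d1 + d2 + x \<in> L" by (intro L_closed L L_x)
      have n6: "\<not> d d0 + d d1 + d d2 + d x \<le> - 2"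
      proof
        assume h6: "d d0 + d d1 + d d2 + d x \<le> - 2"
        have mem7: "d1 - x \<in> L" by (intro L_closed L L_x)
        show False
          using far[OF mem7, unfolded lin_simps]
          by (elim disjE conjE, use C0(1) C1(1,7) C2(2) sum0[of d0] sorted(1,2) X(4) in linarith,
              use C0(1) C1(1,4,7) sum0[of d0] sum0[of d1] R(4) edges(1,2) sorted(1) X(1) in linarith,
              use C0(2) h5 in linarith,
              use C0(2,3) C1(7) C2(2) sum0[of d1] R(4) edges(1,2) X(1) h4 h5 in linarith,
              use C0(1) C1(1,7) C2(2) sum0[of d0] sorted(1,2) X(4) in linarith,
              use C0(2) C1(1,7) C2(2) C3(2) sum0[of d0] sum0[of d1] R(4) sorted(1) X(1,4,5) sum0[of x] h5 h6 in linarith,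
              use C0(2) C1(7) C2(2) C3(7) sum0[of d0] R(3) edges(1) X(6) in linarith,
              use C0(2) C1(1) C3(7) sum0[of d0] sum0[of d1] R(3) edges(1) sorted(2) X(1,7) h5 in linarith,
              use C1(7) C3(2) R(4) h6 in linarith)
      qed
      show False
        using far[OF mem6, unfolded lin_simps]
        by (elim disjE conjE, use C0(3) C2(2) C3(1) R(4) edges(2) X(8) in linarith,
            use C0(2) C1(1,7) C2(2) C3(3) sum0[of d1] R(1) edges(1) h5 in linarith,
            use C2(3) C3(1) sum0[of d2] R(2,4) edges(3) X(1) h5 in linarith,
            use C0(2) C1(7) C2(2) sum0[of d0] sum0[of d1] R(2) edges(1,3) sorted(1,2) X(1,4) h5 in linarith,
            use C0(3) C3(6) R(2) h4 in linarith,
            use C0(2) C1(1,7) C3(7) sum0[of d1] R(3) edges(1) X(1,6) h5 in linarith,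
            use C0(2) C1(7) C2(2) sum0[of d0] R(4) edges(1,2) sorted(1) X(5) in linarith,
            use C0(3) C2(2) C3(1) R(4) edges(2) X(8) in linarith, use n6 in linarith)
    qed
    have n7: "\<not> d d0 + d d1 - d x \<le> - 2"
    proof
      assume h7: "d d0 + d d1 - d x \<le> - 2"
      have mem8: "d2 + x \<in> L" by (intro L_closed L L_x)
      show False
        using far[OF mem8, unfolded lin_simps]
        by (elim disjE conjE,
            use C0(1) C2(1) sum0[of d0] sum0[of d2] R(4) edges(2) sorted(1,2) X(5) sum0[of x] in linarith,
            use C0(3) C2(1,5) C3(2) sum0[of d2] R(4) edges(2) X(5) sum0[of x] h4 h7 in linarith,
            use C2(3) C3(1) sum0[of d2] R(2,4) edges(3) X(1) in linarith,
            use C2(3) C3(2) sum0[of d2] R(2,4) edges(3) X(4) in linarith, use C0(3) C2(5) h4 in linarith,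
            use C0(2) C1(7) C2(2) C3(7) sum0[of d0] R(3) edges(1) X(1) sum0[of x] h4 h7 in linarith,
            use C0(1) C2(1) sum0[of d0] R(4) edges(2) sorted(1,2) X(5) in linarith,
            use C0(3) C2(2,8) C3(1) R(4) X(8) in linarith, use C3(2) R(4) h7 in linarith)
    qed
    show False
      using far[OF mem5, unfolded lin_simps]
      by (elim disjE conjE, use C0(1) C2(1) sum0[of d0] R(4) edges(2) sorted(1,2) X(7) in linarith,
          use n5 in linarith,
          use C0(1) C1(2) C2(1) C3(7) sum0[of d1] sum0[of d2] sum0[of d3] R(1,2,3) edges(2) sorted(1,2) X(2) in linarith,
          use C1(2) h4 in linarith, use C0(2) C1(1,7) C2(2) C3(7) sum0[of d0] R(3) edges(1) X(4) in linarith,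
          use C0(1) C2(1) C3(7) sum0[of d0] R(3,4) edges(2) sorted(1,2) X(5) in linarith,
          use C0(2) C1(7) C2(2) sum0[of d0] R(4) edges(1,2) sorted(1) X(6) in linarith,
          use C0(1) C2(1) sum0[of d0] R(4) edges(2) sorted(1,2) X(7) in linarith, use n7 in linarith)
  qed
  show False
    using far[OF mem1, unfolded lin_simps]
    by (elim disjE conjE, use C0(1) C2(1) sum0[of d0] R(4) edges(2) sorted(1,2) X(3) sum0[of x] in linarith,
        use n1 in linarith, use C0(1) C1(7) C2(2) C3(7) sum0[of d0] R(3) edges(1) X(2) in linarith,
        use C0(1) C2(1) sum0[of d0] R(4) edges(2) sorted(1,2) X(3) in linarith, use n4 in linarith,
        use C0(1) C2(2) C3(7) sum0[of d0] R(3,4) edges(1,2) sorted(2) X(5) in linarith,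
        use C0(2) C1(7) C2(1) sum0[of d0] R(4) edges(2) sorted(1) X(6) in linarith,
        use C0(1) C1(7) C2(1) sum0[of d0] R(4) edges(2) sorted(1) X(7) in linarith,
        use C0(2) C2(2) C3(7) sum0[of d0] R(3,4) edges(1,2) sorted(2) X(8) in linarith)
qed

text \<open>The three edges share the index 0. This configuration is not tight: the reference
  vectors of the hole below have depth at least 5/4. The hypothesis \<open>c d1 \<le> b d2\<close>
  balances two lower bounds for this depth, one decreasing in \<open>c d1\<close> and the other
  increasing in \<open>b d2\<close>.\<close>

lemma star_edges_ordered:
  assumes L: "d0 \<in> L" "d1 \<in> L" "d2 \<in> L" "d3 \<in> L" and rel: "d0 + d1 + d2 + d3 = 0"
    and caps: "cap a b c d d0" "cap b a c d d1" "cap c a b d d2" "cap d a b c d3"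
    and edges: "2 \<le> b d0 + b d1" "2 \<le> c d0 + c d2" "2 \<le> a d3 + a d0"
    and sorted: "c d1 \<le> b d2"
  shows False
proof -
  note C0 = capD[OF caps(1)] and C1 = capD[OF caps(2)] and C2 = capD[OF caps(3)] and C3 = capD[OF caps(4)]
  have R: "a d0 + a d1 + a d2 + a d3 = 0" "b d0 + b d1 + b d2 + b d3 = 0"
    "c d0 + c d1 + c d2 + c d3 = 0" "d d0 + d d1 + d d2 + d d3 = 0"
    using rel by (metis lin_simps)+
  \<comment> \<open>The reference vectors are \<open>d0\<close>, \<open>d0 + d1 + d2\<close>,
    \<open>d0 + d2\<close> and 0 for \<open>a\<close>, \<open>b\<close>, \<open>c\<close>,
    \<open>d\<close>, all at depth S/4 where S is the sum of \<open>a d0\<close>,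
    \<open>b d0 + b d1 + b d2\<close> and \<open>c d0 + c d2\<close>. The edges give S \<ge> 6 +
    \<open>b d2\<close>. Rewriting S through \<open>d3\<close> as
    \<open>a d0 + a d3 + d d3 - c d1\<close> gives S \<ge> 4 - \<open>c d1\<close>. Together with
    the ordering, 2S \<ge> 10.\<close>
  have "\<exists>x. x \<in> L \<and> near (3/4 * a d0 - 1/4 * b d0 - 1/4 * b d1 - 1/4 * b d2 - 1/4 * c d0 - 1/4 * c d2)
      (3/4 * b d0 + 3/4 * b d1 + 3/4 * b d2 - 1/4 * a d0 - 1/4 * c d0 - 1/4 * c d2)
      (3/4 * c d0 + 3/4 * c d2 - 1/4 * a d0 - 1/4 * b d0 - 1/4 * b d1 - 1/4 * b d2)
      (- 1/4 * a d0 - 1/4 * b d0 - 1/4 * b d1 - 1/4 * b d2 - 1/4 * c d0 - 1/4 * c d2) x"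
    by (rule cover') linarith
  then obtain x where L_x: "x \<in> L" and near_x: "near (3/4 * a d0 - 1/4 * b d0 - 1/4 * b d1 - 1/4 * b d2 - 1/4 * c d0 - 1/4 * c d2)
      (3/4 * b d0 + 3/4 * b d1 + 3/4 * b d2 - 1/4 * a d0 - 1/4 * c d0 - 1/4 * c d2)
      (3/4 * c d0 + 3/4 * c d2 - 1/4 * a d0 - 1/4 * b d0 - 1/4 * b d1 - 1/4 * b d2)
      (- 1/4 * a d0 - 1/4 * b d0 - 1/4 * b d1 - 1/4 * b d2 - 1/4 * c d0 - 1/4 * c d2) x" by blast
  note X = nearD[OF near_x]
  have mem1: "d0 - x \<in> L" by (intro L_closed L L_x)
  have n1: "\<not> 2 \<le> a d0 - a x"
  proof
    assume h1: "2 \<le> a d0 - a x"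
    have mem2: "x \<in> L" by (intro L_closed L L_x)
    have n2: "\<not> d x \<le> - 2"
    proof
      assume h2: "d x \<le> - 2"
      have mem3: "d0 + d1 + d2 - x \<in> L" by (intro L_closed L L_x)
      show False
        using far[OF mem3, unfolded lin_simps]
        by (elim disjE conjE, use C0(1) edges(1,2) sorted X(4) sum0[of x] h1 h2 in linarith,
            use C1(5) C3(2) sum0[of d0] sum0[of d1] sum0[of d2] R(1,4) edges(3) X(1) in linarith,
            use C1(3) C2(3) h1 in linarith,
            use C0(7) C1(2) C2(2) C3(5) sum0[of d0] R(2) edges(1) X(6) sum0[of x] h1 h2 in linarith,
            use C0(1) C3(1) sum0[of d3] R(2,3) edges(1,2,3) sorted X(4) in linarith,
            use C0(2) C3(5,7) R(2,3) edges(2) X(4) sum0[of x] h1 h2 in linarith,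
            use C1(5) C3(1) sum0[of d3] R(2,3) edges(3) X(6) in linarith,
            use C1(2,8) C2(3) C3(1) sum0[of d0] sum0[of d2] R(4) X(7) in linarith,
            use C3(2) R(4) h2 in linarith)
    qed
    have n3: "\<not> 2 \<le> c x"
    proof
      assume h3: "2 \<le> c x"
      have mem4: "d2 - x \<in> L" by (intro L_closed L L_x)
      have n4: "\<not> 2 \<le> d d2 - d x"
      proof
        assume h4: "2 \<le> d d2 - d x"
        have mem5: "d0 + d1 + d2 - x \<in> L" by (intro L_closed L L_x)
        show False
          using far[OF mem5, unfolded lin_simps]
          by (elim disjE conjE, use C3(7) R(3) h3 in linarith,
              use C1(5) C3(2) sum0[of d0] sum0[of d1] sum0[of d2] R(1,4) edges(3) X(1) in linarith,
              use C1(3) C2(3) h1 in linarith,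
              use C0(7) C1(2) C2(3,8) sum0[of d0] sum0[of d2] X(6) sum0[of x] h1 h4 in linarith,
              use C0(1) C3(1) sum0[of d3] R(2,3) edges(1,2,3) sorted X(4) in linarith,
              use C3(7) R(3) h3 in linarith, use C1(5) C3(1) sum0[of d3] R(2,3) edges(3) X(6) in linarith,
              use C1(2,8) C2(3) C3(1) sum0[of d0] sum0[of d2] R(4) X(7) in linarith,
              use C0(7) C1(7) h4 in linarith)
      qed
      show False
        using far[OF mem4, unfolded lin_simps]
        by (elim disjE conjE,
            use C0(1,7) C1(2) C3(1) sum0[of d0] sum0[of d3] R(2,3) edges(1,3) sorted X(6) h3 in linarith,
            use C0(1,7) C1(2,3) C2(7) sum0[of d0] sum0[of d2] R(1) edges(3) X(1) in linarith,
            use C0(7) C1(2) C2(2,3) C3(1) sum0[of d0] sum0[of d3] R(2,3) edges(1,3) sorted X(6) h1 h3 in linarith,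
            use C0(7) C1(2) C2(2) C3(5) sum0[of d0] R(2) edges(1) X(3) in linarith,
            use C0(1,7) C1(2) C2(2) C3(1) sum0[of d0] sum0[of d3] R(2,3) edges(3) sorted X(4,6) h3 in linarith,
            use C2(2) h3 in linarith, use C0(1,6) C2(1,5) edges(1) X(6) in linarith, use n4 in linarith,
            use C0(1) C1(3) C2(2,7) sum0[of d2] R(1) edges(1,2,3) X(8) in linarith)
    qed
    show False
      using far[OF mem2, unfolded lin_simps]
      by (elim disjE conjE, use C0(1) C3(1) sum0[of d3] R(2,3) edges(1,2,3) sorted X(8) in linarith,
          use C0(2) h1 in linarith, use C0(1,6) C2(2) C3(5) R(2) X(1) in linarith,
          use C0(1) C3(5) R(2) edges(2) X(4) in linarith,
          use C0(7) C1(2) C2(2) C3(1) sum0[of d0] sum0[of d3] R(2,3) edges(1,3) sorted X(3) in linarith,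
          use n3 in linarith, use C0(2) C3(5) R(2) edges(2) X(5) in linarith,
          use C0(1) C3(1) sum0[of d3] R(2,3) edges(1,2,3) sorted X(8) in linarith, use n2 in linarith)
  qed
  have n5: "\<not> c d0 - c x \<le> - 2"
  proof
    assume h5: "c d0 - c x \<le> - 2"
    have mem6: "d0 + d2 - x \<in> L" by (intro L_closed L L_x)
    have n6: "\<not> 2 \<le> a d0 + a d2 - a x"
    proof
      assume h6: "2 \<le> a d0 + a d2 - a x"
      have mem7: "d2 - x \<in> L" by (intro L_closed L L_x)
      have n7: "\<not> b d2 - b x \<le> - 2"
      proof
        assume h7: "b d2 - b x \<le> - 2"
        have mem8: "d0 + d1 + d2 - x \<in> L" by (intro L_closed L L_x)
        show False
          using far[OF mem8, unfolded lin_simps]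
          by (elim disjE conjE, use C1(3) h6 in linarith,
              use C1(5) C3(2) sum0[of d0] sum0[of d1] sum0[of d2] R(1,4) edges(3) X(1) in linarith,
              use C1(3) h6 in linarith, use C0(1,7) C1(2) C2(2) sum0[of d0] edges(2) h7 in linarith,
              use C0(1) C3(1) sum0[of d3] R(2,3) edges(1,2,3) sorted X(4) in linarith,
              use C2(2) C3(7) R(3) edges(2) h5 in linarith,
              use C1(5) C3(1) sum0[of d3] R(2,3) edges(3) X(6) in linarith,
              use C1(2,8) C3(1) sum0[of d0] sum0[of d2] R(4) X(1,7) h6 in linarith,
              use C0(1,7) C1(2) C2(2) C3(2) sum0[of d0] sum0[of d1] sum0[of d2] R(1,4) edges(2,3) sorted X(1) sum0[of x] h5 h7 in linarith)
      qed
      show False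
        using far[OF mem7, unfolded lin_simps]
        by (elim disjE conjE,
            use C0(1,7) C1(2) C3(1) sum0[of d0] sum0[of d3] R(2,3) edges(1,3) sorted X(6) h5 in linarith,
            use C0(1,7) C1(2,3) C2(7) sum0[of d0] sum0[of d2] R(1) edges(3) X(1) in linarith,
            use C0(2) h6 in linarith, use C0(7) C1(2) C2(2) C3(5) sum0[of d0] R(2) edges(1) X(3) in linarith,
            use n7 in linarith, use C2(2) edges(2) h5 in linarith,
            use C0(1,6) C2(1,5) edges(1) X(6) in linarith,
            use C0(7) C1(2) C3(1) sum0[of d0] sum0[of d1] sum0[of d2] R(1,4) edges(3) sorted X(1,6,7) h5 h6 in linarith,
            use C0(1) C1(3) C2(2,7) sum0[of d2] R(1) edges(1,2,3) X(8) in linarith)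
    qed
    have n8: "\<not> b d0 + b d2 - b x \<le> - 2"
    proof
      assume h8: "b d0 + b d2 - b x \<le> - 2"
      have mem9: "d0 + d1 + d2 - x \<in> L" by (intro L_closed L L_x)
      show False
        using far[OF mem9, unfolded lin_simps]
        by (elim disjE conjE, use C0(1) C2(2) edges(1,2) sorted X(4) h5 in linarith,
            use C1(5) C3(2) sum0[of d0] sum0[of d1] sum0[of d2] R(1,4) edges(3) X(1) in linarith,
            use C1(2,3) C2(2,3) C3(1,4) sum0[of d3] R(1,2,3) edges(1,2) sorted X(7) sum0[of x] h5 h8 in linarith,
            use C1(2) h8 in linarith, use C0(1) C3(1) sum0[of d3] R(2,3) edges(1,2,3) sorted X(4) in linarith,
            use C2(2) C3(7) R(3) edges(2) h5 in linarith,
            use C1(5) C3(1) sum0[of d3] R(2,3) edges(3) X(6) in linarith,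
            use C1(2,8) C2(3) C3(1) sum0[of d0] sum0[of d2] R(4) X(7) in linarith,
            use C0(1) C1(2) C2(2) C3(2) sum0[of d3] R(2,3,4) edges(1,2,3) sorted X(1) sum0[of x] h5 h8 in linarith)
    qed
    have n9: "\<not> d d0 + d d2 - d x \<le> - 2"
    proof
      assume h9: "d d0 + d d2 - d x \<le> - 2"
      have mem10: "d2 - x \<in> L" by (intro L_closed L L_x)
      show False
        using far[OF mem10, unfolded lin_simps]
        by (elim disjE conjE, use C0(7) h9 in linarith,
            use C0(1,7) C1(2,3) C2(7) sum0[of d0] sum0[of d2] R(1) edges(3) X(1) in linarith,
            use C0(2,7) C2(2) C3(5) sum0[of d2] R(2) edges(1,2) X(3) sum0[of x] h5 h9 in linarith,
            use C0(7) C1(2) C2(2) C3(5) sum0[of d0] R(2) edges(1) X(3) in linarith,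
            use C0(1,7) C1(3) C2(2) C3(5) sum0[of d2] R(1,2) edges(2,3) X(1) sum0[of x] h5 h9 in linarith,
            use C2(2) edges(2) h5 in linarith, use C0(1,6) C2(1,5) edges(1) X(6) in linarith,
            use C0(7) h9 in linarith, use C0(1) C1(3) C2(2,7) sum0[of d2] R(1) edges(1,2,3) X(8) in linarith)
    qed
    show False
      using far[OF mem6, unfolded lin_simps]
      by (elim disjE conjE, use C0(1) C3(1) sum0[of d3] R(2,3) edges(1,2,3) sorted X(6) in linarith,
          use n6 in linarith, use C0(1) C2(3) C3(1) sum0[of d3] R(2,3) edges(1,2,3) sorted X(2) in linarith,
          use C0(7) C1(1) C2(2) C3(5) sum0[of d0] R(2) edges(1) X(3) in linarith, use n8 in linarith,
          use C2(2) h5 in linarith, use C0(1) C3(1) sum0[of d3] R(2,3) edges(1,2,3) sorted X(6) in linarith,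
          use C0(1) C1(2) C2(3) C3(1) sum0[of d0] sum0[of d1] sum0[of d2] R(1,4) edges(1,2,3) sorted X(7) in linarith,
          use n9 in linarith)
  qed
  show False
    using far[OF mem1, unfolded lin_simps]
    by (elim disjE conjE, use C0(1) C3(1) sum0[of d3] R(2,3) edges(1,2,3) sorted X(2) in linarith,
        use n1 in linarith, use C0(1) C3(1) sum0[of d3] R(2,3) edges(1,2,3) sorted X(2) in linarith,
        use C0(7) C1(1) C2(2) C3(1) sum0[of d0] sum0[of d3] R(2,3) edges(3) sorted X(3) in linarith,
        use C0(1) C1(2) C3(5) R(2) edges(1,2) X(4) in linarith,
        use C0(7) C1(2) C2(1) C3(5) sum0[of d0] R(2) edges(1) X(5) in linarith, use n5 in linarith,
        use C0(1) C1(2) C2(2) C3(5) sum0[of d0] R(2) edges(1,2) X(7) in linarith,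
        use C0(1,7) C3(1) sum0[of d3] R(2,3) edges(1,2,3) sorted X(8) in linarith)
qed

text \<open>Here \<open>d0\<close> arises as minus half of \<open>d1 + d2 + d3\<close>, which is why
  its hypothesis \<open>top\<close> bounds only \<open>a d0\<close>. The vector
  \<open>d0 + d1\<close> can be long only through \<open>c\<close> or \<open>d\<close> being at most
  -2, and each alternative opens its own hole. In both, \<open>b d0 \<le> -2/3\<close> supplies the
  third term of the estimate m \<ge> (2 + 2 + 2/3)/4.\<close>

lemma doubled_top_ordered:
  assumes L: "d0 \<in> L" "d1 \<in> L" "d2 \<in> L" "d3 \<in> L" and rel: "d0 + d0 + d1 + d2 + d3 = 0"
    and top: "2 \<le> a d0" "a d0 < 7/3"
    and caps: "cap b a c d d1" "cap c a b d d2" "cap d a b c d3"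
    and sorted: "b d0 \<le> c d0" "c d0 \<le> d d0"
  shows False
proof -
  note C1 = capD[OF caps(1)] and C2 = capD[OF caps(2)] and C3 = capD[OF caps(3)]
  have R: "a d0 + a d0 + a d1 + a d2 + a d3 = 0" "b d0 + b d0 + b d1 + b d2 + b d3 = 0"
    "c d0 + c d0 + c d1 + c d2 + c d3 = 0" "d d0 + d d0 + d d1 + d d2 + d d3 = 0"
    using rel by (metis lin_simps)+
  have mem1: "d1 + d0 \<in> L" by (intro L_closed L)
  have n1: "\<not> c d1 + c d0 \<le> - 2"
  proof
    assume h1: "c d1 + c d0 \<le> - 2"
    \<comment> \<open>Equal depth from 0, \<open>d0\<close>, \<open>d0 + d1\<close> and
      \<open>d0 + d0 + d1 + d2\<close>, for \<open>a\<close>, \<open>b\<close>, \<open>c\<close>,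
      \<open>d\<close>. The last of these is \<open>- d3\<close>, so the two terms that are at least
      2 come from \<open>h1\<close> and from \<open>d d3 \<ge> 2\<close>.\<close>
    have "\<exists>x. x \<in> L \<and> near (- 1/4 * b d0 - 1/4 * c d1 - 1/4 * c d0 - 1/4 * d d1 - 1/4 * d d2 - 1/2 * d d0)
        (3/4 * b d0 - 1/4 * c d1 - 1/4 * c d0 - 1/4 * d d1 - 1/4 * d d2 - 1/2 * d d0)
        (3/4 * c d1 + 3/4 * c d0 - 1/4 * b d0 - 1/4 * d d1 - 1/4 * d d2 - 1/2 * d d0)
        (3/4 * d d1 + 3/4 * d d2 + 3/2 * d d0 - 1/4 * b d0 - 1/4 * c d1 - 1/4 * c d0) x"
      by (rule cover') linarith
    then obtain x where L_x: "x \<in> L" and near_x: "near (- 1/4 * b d0 - 1/4 * c d1 - 1/4 * c d0 - 1/4 * d d1 - 1/4 * d d2 - 1/2 * d d0)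
        (3/4 * b d0 - 1/4 * c d1 - 1/4 * c d0 - 1/4 * d d1 - 1/4 * d d2 - 1/2 * d d0)
        (3/4 * c d1 + 3/4 * c d0 - 1/4 * b d0 - 1/4 * d d1 - 1/4 * d d2 - 1/2 * d d0)
        (3/4 * d d1 + 3/4 * d d2 + 3/2 * d d0 - 1/4 * b d0 - 1/4 * c d1 - 1/4 * c d0) x" by blast
    note X = nearD[OF near_x]
    have mem2: "- d0 + x \<in> L" by (intro L_closed L L_x)
    have n2: "\<not> 2 \<le> - b d0 + b x"
    proof
      assume h2: "2 \<le> - b d0 + b x"
      have mem3: "d1 + d2 + d0 + d0 - x \<in> L" by (intro L_closed L L_x)
      have n3: "\<not> d d1 + d d2 + 2 * d d0 - d x \<le> - 2"
      proof
        assume h3: "d d1 + d d2 + 2 * d d0 - d x \<le> - 2"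
        have mem4: "d1 + d0 - x \<in> L" by (intro L_closed L L_x)
        show False
          using far[OF mem4, unfolded lin_simps]
          by (elim disjE conjE,
              use C3(1) top(1) sum0[of d0] sum0[of d1] sum0[of d2] sum0[of d3] R(1,2,3) sorted(1,2) h1 X(5) sum0[of x] in linarith,
              use C2(3) C3(1,3) top(1) sum0[of d0] R(1,4) sorted(1,2) h1 X(1) in linarith,
              use C1(2,3) C2(7) sum0[of d0] sum0[of d1] sorted(1,2) X(5) sum0[of x] h2 h3 in linarith,
              use C1(2) h2 in linarith,
              use C1(1,5) C2(3,7) C3(2,3) sum0[of d0] sum0[of d1] R(1,4) X(4) in linarith,
              use C3(1) top(1) sum0[of d0] R(4) sorted(1,2) h1 X(5) in linarith,
              use C1(2,5) C2(3,7) C3(2,3) sum0[of d0] sum0[of d1] R(1,4) X(1) sum0[of x] h2 h3 in linarith,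
              use C1(8) C2(7) C3(2) R(4) h3 in linarith,
              use C1(2) C2(3) C3(1,3) top(1) sum0[of d1] sum0[of d2] sum0[of d3] R(1,2,3,4) sorted(1,2) h1 X(8) in linarith)
      qed
      show False
        using far[OF mem3, unfolded lin_simps]
        by (elim disjE conjE,
            use C3(1) top(1) sum0[of d1] sum0[of d2] sum0[of d3] R(1,2,3,4) sorted(1,2) h1 X(7) in linarith,
            use C3(1,3) top(1) sum0[of d0] R(1,4) sorted(1,2) h1 X(1) in linarith,
            use C1(2,3) C2(2,3,7) C3(5) top(1) sum0[of d0] sum0[of d1] sum0[of d3] R(1,3,4) sorted(2) X(2) in linarith,
            use C1(2) C2(6) C3(5) R(2) h2 in linarith,
            use C2(2) C3(1,3) top(1) sum0[of d1] sum0[of d2] sum0[of d3] R(1,2,3,4) sorted(1,2) h1 X(4) in linarith,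
            use C1(5) C2(2) C3(1) top(1) sum0[of d0] R(4) sorted(2) h1 X(5) in linarith,
            use C1(2) C2(6) C3(2,3,8) sum0[of d3] R(2,3,4) h1 X(6) in linarith,
            use C3(1) top(1) sum0[of d0] R(4) sorted(1,2) h1 X(7) in linarith, use n3 in linarith)
    qed
    have n4: "\<not> - a d0 + a x \<le> - 2"
    proof
      assume h4: "- a d0 + a x \<le> - 2"
      have mem5: "x \<in> L" by (intro L_closed L L_x)
      have n5: "\<not> c x \<le> - 2"
      proof
        assume h5: "c x \<le> - 2"
        have mem6: "d1 + d0 - x \<in> L" by (intro L_closed L L_x)
        show False
          using far[OF mem6, unfolded lin_simps]
          by (elim disjE conjE, use C1(3) h4 in linarith,
              use C2(3) C3(1,3) top(1) sum0[of d0] R(1,4) sorted(1,2) h1 X(1) in linarith,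
              use C1(3) h4 in linarith,
              use C1(2,5) C3(1) top(2) sum0[of d0] R(4) sorted(1,2) X(8) sum0[of x] h4 h5 in linarith,
              use C1(1,5) C2(3,7) C3(2,3) sum0[of d0] sum0[of d1] R(1,4) X(4) in linarith,
              use C3(1) top(1) sum0[of d0] R(4) sorted(1,2) h1 X(5) in linarith,
              use C1(5) C2(2) C3(8) R(3) h5 in linarith,
              use C1(8) C2(2,7) C3(8) top(2) sum0[of d0] R(3) sorted(1) X(4) sum0[of x] h4 h5 in linarith,
              use C1(2) C2(3) C3(1,3) top(1) sum0[of d1] sum0[of d2] sum0[of d3] R(1,2,3,4) sorted(1,2) h1 X(8) in linarith)
      qed
      have n6: "\<not> d x \<le> - 2"
      proof
        assume h6: "d x \<le> - 2"
        have mem7: "d1 + d2 + d0 - x \<in> L" by (intro L_closed L L_x)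
        show False
          using far[OF mem7, unfolded lin_simps]
          by (elim disjE conjE, use C3(1,3) top(1) sum0[of d0] R(1,4) sorted(1) h1 X(1) h6 in linarith,
              use C3(1,3) top(1) sum0[of d0] R(1,4) sorted(1,2) h1 X(1) in linarith,
              use C1(3) C2(3) h4 in linarith,
              use C1(2) C2(6) C3(2,5) top(2) R(2,4) h1 X(6) sum0[of x] h4 h6 in linarith,
              use C2(2) C3(1,3) top(1) sum0[of d1] sum0[of d2] sum0[of d3] R(1,2,3,4) sorted(1,2) h1 X(4) in linarith,
              use C2(2) C3(2) top(2) sum0[of d0] R(4) sorted(1,2) h1 X(4) sum0[of x] h4 h6 in linarith,
              use C1(2,5) C2(1,6) C3(2,3) sum0[of d3] R(2,3,4) X(6) in linarith,
              use C3(1) top(2) sum0[of d0] R(4) sorted(1,2) h1 X(7) in linarith,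
              use C1(7) C2(7) C3(2) R(4) h6 in linarith)
      qed
      show False
        using far[OF mem5, unfolded lin_simps]
        by (elim disjE conjE,
            use C3(1) sum0[of d1] sum0[of d2] sum0[of d3] R(1,2,3,4) sorted(1,2) h1 X(1) h4 in linarith,
            use top(2) h4 in linarith, use C3(1) top(1) sum0[of d0] R(4) sorted(1,2) h1 X(1) in linarith,
            use C1(5) C3(2) sum0[of d0] R(4) sorted(1,2) X(1,4) h4 in linarith,
            use C1(2,5) C2(2,6) C3(1,3) sum0[of d3] R(2,3,4) h1 X(3) in linarith,
            use C1(2) C2(6) C3(2,6) R(2,4) h1 X(6) in linarith, use n5 in linarith,
            use C1(2,5) C2(2,6) C3(1,3) sum0[of d3] R(2,3,4) X(8) in linarith, use n6 in linarith)
    qed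
    show False
      using far[OF mem2, unfolded lin_simps]
      by (elim disjE conjE,
          use C3(1) top(1) sum0[of d1] sum0[of d2] sum0[of d3] R(1,2,3,4) sorted(1,2) h1 X(3) in linarith,
          use C1(5,7) C2(7) C3(2) top(1) sum0[of d0] R(4) X(2) in linarith, use n4 in linarith,
          use n2 in linarith, use C3(1) top(1) sum0[of d0] R(4) sorted(1,2) h1 X(3) in linarith,
          use C1(2) C2(2,3,6,7) C3(1,3) sum0[of d0] sum0[of d1] sum0[of d3] R(1,2,3) sorted(1) h1 X(6) in linarith,
          use C1(5) C3(1) top(1) sum0[of d0] R(4) sorted(1,2) X(5) in linarith,
          use C1(5) C3(1) top(2) sum0[of d0] R(4) sorted(1,2) X(8) in linarith,
          use C1(2) C2(3,7) C3(2,3) top(1) sum0[of d0] sum0[of d1] R(1,4) sorted(1) h1 X(7) in linarith)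
  qed
  have n7: "\<not> d d1 + d d0 \<le> - 2"
  proof
    assume h7: "d d1 + d d0 \<le> - 2"
    \<comment> \<open>The reference vectors are 0, \<open>d0\<close>, \<open>- d2\<close>,
      \<open>d0 + d1\<close>, as for cyclic edges; the two terms that are at least 2 are now
      \<open>c d2\<close> and, by \<open>h7\<close>, \<open>- (d d0 + d d1)\<close>.\<close>
    have "\<exists>x2. x2 \<in> L \<and> near (- 1/4 * b d0 + 1/4 * c d2 - 1/4 * d d1 - 1/4 * d d0)
        (3/4 * b d0 + 1/4 * c d2 - 1/4 * d d1 - 1/4 * d d0)
        (- 3/4 * c d2 - 1/4 * b d0 - 1/4 * d d1 - 1/4 * d d0)
        (3/4 * d d1 + 3/4 * d d0 - 1/4 * b d0 + 1/4 * c d2) x2"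
      by (rule cover') linarith
    then obtain x2 where L_x2: "x2 \<in> L" and near_x2: "near (- 1/4 * b d0 + 1/4 * c d2 - 1/4 * d d1 - 1/4 * d d0)
        (3/4 * b d0 + 1/4 * c d2 - 1/4 * d d1 - 1/4 * d d0)
        (- 3/4 * c d2 - 1/4 * b d0 - 1/4 * d d1 - 1/4 * d d0)
        (3/4 * d d1 + 3/4 * d d0 - 1/4 * b d0 + 1/4 * c d2) x2" by blast
    note X2 = nearD[OF near_x2]
    have mem8: "- d0 + x2 \<in> L" by (intro L_closed L L_x2)
    have n8: "\<not> 2 \<le> - b d0 + b x2"
    proof
      assume h8: "2 \<le> - b d0 + b x2"
      have mem9: "d2 + x2 \<in> L" by (intro L_closed L L_x2)
      have n9: "\<not> 2 \<le> c d2 + c x2"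
      proof
        assume h9: "2 \<le> c d2 + c x2"
        have mem10: "d1 + d0 - x2 \<in> L" by (intro L_closed L L_x2)
        show False
          using far[OF mem10, unfolded lin_simps]
          by (elim disjE conjE,
              use C2(1) top(1) sum0[of d1] sum0[of d2] sum0[of d3] R(1,2,3,4) sorted(1,2) h7 X2(7) in linarith,
              use C2(1,3) C3(3) top(1) sum0[of d0] R(1) sorted(1,2) h7 X2(1) in linarith,
              use C1(2,3,7) C2(2) C3(7) top(1) sum0[of d0] sum0[of d1] R(3) X2(7) sum0[of x2] h8 h9 in linarith,
              use C1(2) h8 in linarith, use C1(1,7) C2(2,3) C3(2,6) sum0[of d2] R(2,4) X2(4) in linarith,
              use C1(6) C2(2) C3(7) R(3) h9 in linarith,
              use C1(2) C2(1,3) C3(3) top(1) sum0[of d0] sum0[of d1] R(1) sorted(1,2) h7 X2(6) in linarith,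
              use C2(1) top(1) sum0[of d0] sorted(1,2) h7 X2(7) in linarith,
              use C1(2,7) C2(2,3) C3(2,6) sum0[of d2] R(2,4) X2(1) sum0[of x2] h8 h9 in linarith)
      qed
      show False
        using far[OF mem9, unfolded lin_simps]
        by (elim disjE conjE,
            use C2(1) top(1) sum0[of d1] sum0[of d2] sum0[of d3] R(1,2,3,4) sorted(1,2) h7 X2(5) in linarith,
            use C1(2,3,7) C2(2) C3(2,3,6) top(1) sum0[of d2] R(1,2,4) X2(2) in linarith,
            use C2(1,3) top(1) sum0[of d0] sorted(1,2) h7 X2(1) in linarith,
            use C1(7) C2(1,3) C3(2) top(1) sum0[of d0] sum0[of d2] R(4) sorted(1) h7 X2(4) in linarith,
            use C1(2) C2(5) C3(6) R(2) h8 in linarith, use n9 in linarith,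
            use C2(1) top(1) sum0[of d0] sorted(1,2) h7 X2(5) in linarith,
            use C1(2) C2(2,3,8) C3(6) sum0[of d2] R(2) h7 X2(8) in linarith,
            use C1(7) C2(1) C3(2) top(1) sum0[of d0] R(4) sorted(1) h7 X2(7) in linarith)
    qed
    have n10: "\<not> - a d0 + a x2 \<le> - 2"
    proof
      assume h10: "- a d0 + a x2 \<le> - 2"
      have mem11: "x2 \<in> L" by (intro L_closed L L_x2)
      have n11: "\<not> c x2 \<le> - 2"
      proof
        assume h11: "c x2 \<le> - 2"
        have mem12: "d2 + d0 + x2 \<in> L" by (intro L_closed L L_x2)
        show False
          using far[OF mem12, unfolded lin_simps]
          by (elim disjE conjE, use C2(3) top(1) sum0[of d0] sorted(1,2) h7 X2(1) h11 in linarith,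
              use C1(3) C3(3) R(1) h10 in linarith,
              use C2(1,3) top(1) sum0[of d0] sorted(1,2) h7 X2(1) in linarith,
              use C1(7) C2(1,3) C3(2) top(1) sum0[of d0] sum0[of d2] R(4) sorted(1) h7 X2(4) in linarith,
              use C1(2) C2(2,5) C3(6) top(2) R(2) h7 X2(8) sum0[of x2] h10 h11 in linarith,
              use C1(7) C2(2) sorted(2) h7 h11 in linarith,
              use C1(7) C2(1) top(2) sum0[of d0] sorted(1) h7 X2(5) in linarith,
              use C1(2,7) C2(2,3) C3(1,6) sum0[of d2] R(2,4) X2(8) in linarith,
              use C2(2) C3(2) top(2) sum0[of d0] R(4) sorted(1,2) h7 X2(4) sum0[of x2] h10 h11 in linarith)
      qed
      have n12: "\<not> d x2 \<le> - 2"
      proof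
        assume h12: "d x2 \<le> - 2"
        have mem13: "d1 + d0 - x2 \<in> L" by (intro L_closed L L_x2)
        show False
          using far[OF mem13, unfolded lin_simps]
          by (elim disjE conjE, use C1(3) h10 in linarith,
              use C2(1,3) C3(3) top(1) sum0[of d0] R(1) sorted(1,2) h7 X2(1) in linarith,
              use C1(3) h10 in linarith,
              use C1(2) C2(1,8) C3(2) top(2) sum0[of d0] R(4) sorted(1,2) X2(6) sum0[of x2] h10 h12 in linarith,
              use C1(1,7) C2(2,3) C3(2,6) sum0[of d2] R(2,4) X2(4) in linarith,
              use C1(6) C2(8) C3(2,7) top(2) sum0[of d0] R(3,4) sorted(1,2) X2(4) sum0[of x2] h10 h12 in linarith,
              use C1(2) C2(1,3) C3(3) top(1) sum0[of d0] sum0[of d1] R(1) sorted(1,2) h7 X2(6) in linarith,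
              use C2(1) top(1) sum0[of d0] sorted(1,2) h7 X2(7) in linarith,
              use C1(7) C2(8) C3(2) R(4) h12 in linarith)
      qed
      show False
        using far[OF mem11, unfolded lin_simps]
        by (elim disjE conjE,
            use C2(1) sum0[of d1] sum0[of d2] sum0[of d3] R(1,2,3,4) sorted(1,2) h7 X2(1) sum0[of x2] h10 in linarith,
            use top(2) h10 in linarith, use C2(1) top(1) sum0[of d0] sorted(1,2) h7 X2(1) in linarith,
            use C1(7) C2(2) sum0[of d0] sorted(1,2) X2(1,4) h10 in linarith,
            use C1(2,7) C2(1,3) C3(2,6) sum0[of d2] R(2,4) h7 X2(3) in linarith,
            use C1(2,7) C2(1,3) C3(2,6) sum0[of d2] R(2,4) X2(6) in linarith, use n11 in linarith,
            use C1(2) C2(2,6) C3(6) R(2) h7 X2(8) in linarith, use n12 in linarith)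
    qed
    show False
      using far[OF mem8, unfolded lin_simps]
      by (elim disjE conjE,
          use C2(1) top(1) sum0[of d1] sum0[of d2] sum0[of d3] R(1,2,3,4) sorted(1,2) h7 X2(3) in linarith,
          use C1(2,7) C2(2,3) C3(2,6) top(1) sum0[of d2] R(2,4) X2(2) in linarith, use n10 in linarith,
          use n8 in linarith, use C2(1) top(1) sum0[of d0] sorted(1,2) h7 X2(3) in linarith,
          use C1(7) C2(1) top(2) sum0[of d0] sorted(1) h7 X2(6) in linarith,
          use C1(7) C2(2) top(1) sum0[of d0] sorted(2) h7 X2(5) in linarith,
          use C2(2) top(2) sum0[of d0] sorted(1,2) h7 X2(8) in linarith,
          use C1(7) C2(1) top(1) sum0[of d0] sorted(1) h7 X2(7) in linarith)
  qed
  show False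
    using far[OF mem1, unfolded lin_simps]
    by (elim disjE conjE, use C1(3) top(1) in linarith, use C2(3) C3(3) top(1) R(1) in linarith,
        use C1(3) top(1) in linarith, use C1(2) top(1) sum0[of d0] sorted(1,2) in linarith,
        use C1(1) C2(6) C3(6) R(2) in linarith, use C1(6) C2(1) C3(7) R(3) in linarith, use n1 in linarith,
        use C1(8) C2(7) C3(1) R(4) in linarith, use n7 in linarith)
qed

text \<open>The difference \<open>d1 + d2 + d3 - z\<close>, which equals \<open>z - d0\<close>, is
  too short to be nonzero, so \<open>d1 + d2 + d3 = z = d0\<close>. The holes are then the midpoints
  between 0 and \<open>d1 + d3\<close> and between 0 and \<open>d1 + d2\<close>: covering both
  forces these two sums to be shorter than the caps allow.\<close>

lemma quadruple_top:
  assumes L: "d0 \<in> L" "d1 \<in> L" "d2 \<in> L" "d3 \<in> L" "z \<in> L" and rel: "d0 + d1 + d2 + d3 = z + z"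
    and caps: "cap a b c d d0" "cap b a c d d1" "cap c a b d d2" "cap d a b c d3"
    and top: "2 \<le> a z"
  shows False
proof -
  note C0 = capD[OF caps(1)] and C1 = capD[OF caps(2)] and C2 = capD[OF caps(3)] and C3 = capD[OF caps(4)]
  have R: "a d0 + a d1 + a d2 + a d3 = a z + a z" "b d0 + b d1 + b d2 + b d3 = b z + b z"
    "c d0 + c d1 + c d2 + c d3 = c z + c z" "d d0 + d d1 + d d2 + d d3 = d z + d z"
    using rel by (metis lin_simps)+
  have mem1: "d1 + d2 + d3 - z \<in> L" by (intro L_closed L)
  have n1: False if h1: "a d1 + a d2 + a d3 - a z = 0" "b d1 + b d2 + b d3 - b z = 0" "c d1 + c d2 + c d3 - c z = 0" "d d1 + d d2 + d d3 - d z = 0"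
  proof -
    \<comment> \<open>Only the ends 0 and \<open>d1 + d3\<close> can cover this midpoint, and either
      one gives \<open>c d1 + c d3 > -7/3\<close>. In the same way the midpoint for
      \<open>d1 + d2\<close> gives \<open>d d1 + d d2 > -7/3\<close>. Then the four functionals on
      \<open>d1 + d2 + d3\<close> are at least 2 for \<open>a\<close> and above -10/9, -1/3, -1/3
      for \<open>b\<close>, \<open>c\<close>, \<open>d\<close>, so their sum would be
      positive.\<close>
    have "\<exists>x. x \<in> L \<and> near (1/2 * a d1 + 1/2 * a d3) (1/2 * b d1 + 1/2 * b d3)
        (1/2 * c d1 + 1/2 * c d3) (1/2 * d d1 + 1/2 * d d3) x"
      by (rule cover') (use sum0[of d1] sum0[of d3] in linarith)
    then obtain x where L_x: "x \<in> L" and near_x: "near (1/2 * a d1 + 1/2 * a d3) (1/2 * b d1 + 1/2 * b d3)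
        (1/2 * c d1 + 1/2 * c d3) (1/2 * d d1 + 1/2 * d d3) x" by blast
    note X = nearD[OF near_x]
    have mem2: "d1 + d3 - x \<in> L" by (intro L_closed L L_x)
    have n2: False if h2: "a d1 + a d3 - a x = 0" "b d1 + b d3 - b x = 0" "c d1 + c d3 - c x = 0" "d d1 + d d3 - d x = 0"
    proof -
      have "\<exists>x2. x2 \<in> L \<and> near (1/2 * a d1 + 1/2 * a d2) (1/2 * b d1 + 1/2 * b d2)
          (1/2 * c d1 + 1/2 * c d2) (1/2 * d d1 + 1/2 * d d2) x2"
        by (rule cover') (use sum0[of d1] sum0[of d2] in linarith)
      then obtain x2 where L_x2: "x2 \<in> L" and near_x2: "near (1/2 * a d1 + 1/2 * a d2)
          (1/2 * b d1 + 1/2 * b d2) (1/2 * c d1 + 1/2 * c d2) (1/2 * d d1 + 1/2 * d d2) x2" by blast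
      note X2 = nearD[OF near_x2]
      have mem3: "x2 \<in> L" by (intro L_closed L L_x2)
      have n3: "\<not> d x2 \<le> - 2"
      proof
        assume h3: "d x2 \<le> - 2"
        have mem4: "d1 + d2 - x2 \<in> L" by (intro L_closed L L_x2)
        show False
          using far[OF mem4, unfolded lin_simps]
          by (elim disjE conjE, use C1(1) C2(1,5) C3(1,5) sum0[of z] top h1(2,3,4) X(5) h2(3) X2(7) in linarith,
              use C1(4) C2(4) X2(1) in linarith, use C3(4) top h1(1) X2(2) in linarith,
              use C1(7) C2(1,7) C3(1,5) sum0[of d1] sum0[of d2] sum0[of d3] top h1(1) X(5) h2(3) X2(3) in linarith,
              use C1(1) C2(5) X2(4) in linarith,
              use C1(1,7) C2(2,4) C3(4) sum0[of d1] top h1(1) X2(5) in linarith,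
              use C1(5) C2(1) X2(6) in linarith, use X2(7) h3 in linarith, use C1(7) C2(7) h3 in linarith)
      qed
      show False
        using far[OF mem3, unfolded lin_simps]
        by (elim disjE conjE, use C1(1) C2(1,5) C3(1,5) sum0[of z] top h1(2,3,4) X(5) h2(3) X2(8) in linarith,
            use C1(4) C2(4) X2(2) in linarith, use C3(4) top h1(1) X2(1) in linarith,
            use C1(7) C2(1,7) C3(1,5) sum0[of d1] sum0[of d2] sum0[of d3] top h1(1) X(5) h2(3) X2(4) in linarith,
            use C1(1) C2(5) X2(3) in linarith,
            use C1(1,7) C2(2,4) C3(4) sum0[of d1] top h1(1) X2(6) in linarith,
            use C1(5) C2(1) X2(5) in linarith, use C0(8) C3(1) R(4) h1(4) X2(8) in linarith, use n3 in linarith)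
    qed
    have n4: "\<not> c d1 + c d3 - c x \<le> - 2"
    proof
      assume h4: "c d1 + c d3 - c x \<le> - 2"
      have mem5: "x \<in> L" by (intro L_closed L L_x)
      \<comment> \<open>The other end, \<open>x = 0\<close>. By the symmetry about the midpoint it
        yields the same bound on \<open>c d1 + c d3\<close>, and the second midpoint is used as
        before.\<close>
      have n5: False if h5: "a x = 0" "b x = 0" "c x = 0" "d x = 0"
      proof -
        have "\<exists>x3. x3 \<in> L \<and> near (1/2 * a d1 + 1/2 * a d2) (1/2 * b d1 + 1/2 * b d2)
            (1/2 * c d1 + 1/2 * c d2) (1/2 * d d1 + 1/2 * d d2) x3"
          by (rule cover') (use sum0[of d1] sum0[of d2] in linarith)
        then obtain x3 where L_x3: "x3 \<in> L" and near_x3: "near (1/2 * a d1 + 1/2 * a d2)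
            (1/2 * b d1 + 1/2 * b d2) (1/2 * c d1 + 1/2 * c d2) (1/2 * d d1 + 1/2 * d d2) x3" by blast
        note X3 = nearD[OF near_x3]
        have mem6: "x3 \<in> L" by (intro L_closed L L_x3)
        have n6: "\<not> d x3 \<le> - 2"
        proof
          assume h6: "d x3 \<le> - 2"
          have mem7: "d1 + d2 - x3 \<in> L" by (intro L_closed L L_x3)
          show False
            using far[OF mem7, unfolded lin_simps]
            by (elim disjE conjE,
                use C1(1) C2(1,5) C3(1,5) sum0[of d1] sum0[of d2] sum0[of d3] top h1(1) X(6) h5(3) X3(7) in linarith,
                use C1(4) C2(4) X3(1) in linarith, use C3(4) top h1(1) X3(2) in linarith,
                use C1(7) C2(1,7) C3(1,5) sum0[of d1] sum0[of d2] sum0[of d3] top h1(1) X(6) h5(3) X3(3) in linarith,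
                use C1(1) C2(5) X3(4) in linarith,
                use C1(1,7) C2(2,4) C3(4) sum0[of d1] top h1(1) X3(5) in linarith,
                use C1(5) C2(1) X3(6) in linarith, use X3(7) h6 in linarith, use C1(7) C2(7) h6 in linarith)
        qed
        show False
          using far[OF mem6, unfolded lin_simps]
          by (elim disjE conjE,
              use C1(1) C2(1,5) C3(1,5) sum0[of d1] sum0[of d2] sum0[of d3] top h1(1) X(6) h5(3) X3(8) in linarith,
              use C1(4) C2(4) X3(2) in linarith, use C3(4) top h1(1) X3(1) in linarith,
              use C1(7) C2(1,7) C3(1,5) sum0[of d1] sum0[of d2] sum0[of d3] top h1(1) X(6) h5(3) X3(4) in linarith,
              use C1(1) C2(5) X3(3) in linarith,
              use C1(1,7) C2(2,4) C3(4) sum0[of d1] top h1(1) X3(6) in linarith,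
              use C1(5) C2(1) X3(5) in linarith, use C0(8) C3(1) R(4) h1(4) X3(8) in linarith,
              use n6 in linarith)
      qed
      show False
        using far[OF mem5, unfolded lin_simps]
        by (elim disjE conjE, use n5 in blast, use C1(4) C3(4) X(2) in linarith,
            use C2(4) top h1(1) X(1) in linarith,
            use C1(2,4) C2(4) C3(1,7) sum0[of d3] top h1(1) X(4) in linarith, use C1(1) C3(5) X(3) in linarith,
            use X(6) h4 in linarith, use C1(5) C3(7) h4 in linarith,
            use C1(1,5) C2(4) C3(2,4) sum0[of d1] top h1(1) X(8) in linarith, use C1(7) C3(1) X(7) in linarith)
    qed
    show False
      using far[OF mem2, unfolded lin_simps]
      by (elim disjE conjE, use n2 in blast, use C1(4) C3(4) X(1) in linarith,
          use C2(4) top h1(1) X(2) in linarith,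
          use C1(2,4) C2(4) C3(1,7) sum0[of d3] top h1(1) X(3) in linarith, use C1(1) C3(5) X(4) in linarith,
          use C0(6) C2(1) R(3) h1(3) X(5) in linarith, use n4 in linarith,
          use C1(1,5) C2(4) C3(2,4) sum0[of d1] top h1(1) X(7) in linarith, use C1(7) C3(1) X(8) in linarith)
  qed
  show False
    using far[OF mem1, unfolded lin_simps]
    by (elim disjE conjE, use n1 in blast, use C0(1) C1(4) C2(4) C3(4) R(1) in linarith,
        use C0(2) R(1) top in linarith,
        use C0(2,3) C1(2,4) C2(1,7) C3(1,7) sum0[of d2] sum0[of d3] R(1,2) top in linarith,
        use C0(4) C1(1) C2(5) C3(5) R(2) in linarith,
        use C0(2,5) C1(1,7) C2(2,4) C3(1,5) sum0[of d1] sum0[of d3] R(1,3) top in linarith,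
        use C0(6) C1(5) C2(1) C3(7) R(3) in linarith,
        use C0(2,7) C1(1,5) C2(1,5) C3(2,4) sum0[of d1] sum0[of d2] R(1,4) top in linarith,
        use C0(8) C1(7) C2(7) C3(1) R(4) in linarith)
qed

text \<open>The known vectors \<open>d1\<close>, \<open>d2\<close>, \<open>d3\<close> span at most a
  plane. The obstacle is therefore that they do not suffice as reference vectors: the vectors found
  in the first two holes have to serve in the construction of further holes.\<close>

lemma planar_triple_ordered:
  assumes L: "d1 \<in> L" "d2 \<in> L" "d3 \<in> L" and rel: "d1 + d2 + d3 = 0"
    and caps: "cap b a c d d1" "cap c a b d d2" "cap d a b c d3"
    and sorted: "a d3 \<le> a d2" "a d2 \<le> a d1"
  shows False
proof -
  note C1 = capD[OF caps(1)] and C2 = capD[OF caps(2)] and C3 = capD[OF caps(3)]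
  have R: "a d1 + a d2 + a d3 = 0" "b d1 + b d2 + b d3 = 0" "c d1 + c d2 + c d3 = 0" "d d1 + d d2 + d d3 = 0"
    using rel by (metis lin_simps)+
  \<comment> \<open>Three coordinates lie exactly 7/6 beyond \<open>d2\<close> (for
    \<open>b\<close>), 0 (for \<open>c\<close>) and \<open>d1 + d2\<close> (for \<open>d\<close>);
    the first coordinate makes the sum zero. By strictness \<open>b x > b d2\<close>,
    \<open>c x > 0\<close> and \<open>d x > d d1 + d d2\<close>.\<close>
  have "\<exists>x. x \<in> L \<and> near (- b d2 - d d1 - d d2 - 7/2) (b d2 + 7/6) (7/6) (d d1 + d d2 + 7/6) x"
    by (rule cover') linarith
  then obtain x where L_x: "x \<in> L" and near_x: "near (- b d2 - d d1 - d d2 - 7/2) (b d2 + 7/6) (7/6)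
      (d d1 + d d2 + 7/6) x" by blast
  note X = nearD[OF near_x]
  \<comment> \<open>The same construction with the reference vectors \<open>- d1\<close>, 0,
    \<open>d2\<close> for \<open>b\<close>, \<open>c\<close>, \<open>d\<close>.\<close>
  have "\<exists>x2. x2 \<in> L \<and> near (b d1 - d d2 - 7/2) (- b d1 + 7/6) (7/6) (d d2 + 7/6) x2"
    by (rule cover') linarith
  then obtain x2 where L_x2: "x2 \<in> L" and near_x2: "near (b d1 - d d2 - 7/2) (- b d1 + 7/6) (7/6)
      (d d2 + 7/6) x2" by blast
  note X2 = nearD[OF near_x2]
  have mem1: "d1 + x2 \<in> L" by (intro L_closed L L_x2)
  \<comment> \<open>The sum \<open>d1 + x2\<close> can be long only through
    \<open>d \<le> -2\<close>, \<open>b \<ge> 2\<close> or \<open>a \<le> -2\<close>. The first and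
    the last alternative are settled with \<open>x\<close> and \<open>x2\<close> alone; only
    \<open>b \<ge> 2\<close> needs further holes.\<close>
  have n1: "\<not> d d1 + d x2 \<le> - 2"
  proof
    assume h1: "d d1 + d x2 \<le> - 2"
    have mem2: "d2 - x2 \<in> L" by (intro L_closed L L_x2)
    have n2: "\<not> 2 \<le> a d2 - a x2"
    proof
      assume h2: "2 \<le> a d2 - a x2"
      have mem3: "x \<in> L" by (intro L_closed L L_x)
      have n3: "\<not> d x \<le> - 2"
      proof
        assume h3: "d x \<le> - 2"
        have mem4: "d1 + d2 + d2 - x \<in> L" by (intro L_closed L L_x)
        have n4: "\<not> 2 \<le> a d1 + 2 * a d2 - a x"
        proof
          assume h4: "2 \<le> a d1 + 2 * a d2 - a x"
          have mem5: "d1 + d2 - x + x2 \<in> L" by (intro L_closed L L_x L_x2)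
          show False
            using far[OF mem5, unfolded lin_simps]
            by (elim disjE conjE, use C1(7) X(7) h1 in linarith,
                use C1(1,5) C2(1,4) sum0[of d1] sum0[of d2] X(1) h2 in linarith,
                use C1(1) C2(1,5) sum0[of d2] X2(1) h4 in linarith,
                use C1(1,5) C2(1,4) C3(2) sum0[of d1] sum0[of d2] R(4) X(6) sum0[of x] X2(4) h3 h4 in linarith,
                use C1(1) C2(1,5) C3(2) sum0[of d2] R(4) X(4) X2(6) sum0[of x2] h1 h2 in linarith,
                use C1(1) C2(4) C3(2) sum0[of d1] sum0[of d2] R(4) X(4) sum0[of x] X2(6) h3 h4 in linarith,
                use C2(1) C3(3) sum0[of d1] R(1) X(6) X2(4) sum0[of x2] h1 h2 in linarith,
                use C1(7) X(7) h1 in linarith,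
                use C1(1,5) C3(2) sum0[of d1] R(4) sorted(2) X2(1,7) h2 h3 in linarith)
        qed
        have n5: "\<not> 2 \<le> c d1 + 2 * c d2 - c x"
        proof
          assume h5: "2 \<le> c d1 + 2 * c d2 - c x"
          have mem6: "d1 + d2 - x \<in> L" by (intro L_closed L L_x)
          show False
            using far[OF mem6, unfolded lin_simps]
            by (elim disjE conjE, use sum0[of d3] R(1,2,3,4) X(7) sum0[of x] in linarith,
                use C1(1) C2(2) C3(2) sum0[of d1] sum0[of d2] R(4) X(4) sum0[of x] h3 h5 in linarith,
                use C1(7) C2(5) C3(7) sum0[of d1] sum0[of d2] R(1,3) sorted(1,2) X(2) X2(1) h2 in linarith,
                use C2(5) C3(2,7) sum0[of d2] R(3,4) X(2) sum0[of x] X2(1) h2 h3 h5 in linarith,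
                use C1(1) X(4) in linarith, use C3(7) R(3) X(5) in linarith, use C2(2) h5 in linarith,
                use X(7) in linarith, use C3(2) R(4) h3 in linarith)
        qed
        show False
          using far[OF mem4, unfolded lin_simps]
          by (elim disjE conjE, use C1(7) C3(1) R(4) X(7) in linarith, use n4 in linarith,
              use C1(7) C2(5) C3(7) sum0[of d1] sum0[of d2] R(1,3) sorted(1) X(2) X2(1) h2 in linarith,
              use C2(1) sum0[of d2] X(3) X2(1) h2 in linarith, use C1(1) C2(5) X(4) in linarith,
              use n5 in linarith, use C1(5) C2(1) X(6) in linarith, use C1(7) C3(1) R(4) X(7) in linarith,
              use C1(1,5) C3(2) sum0[of d1] R(4) sorted(2) X2(1) h2 h3 in linarith)
      qed
      have n6: "\<not> 2 \<le> c x"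
      proof
        assume h6: "2 \<le> c x"
        have mem7: "d2 - x \<in> L" by (intro L_closed L L_x)
        have n7: "\<not> b d2 - b x \<le> - 2"
        proof
          assume h7: "b d2 - b x \<le> - 2"
          have mem8: "d1 + d2 - x + x2 \<in> L" by (intro L_closed L L_x L_x2)
          show False
            using far[OF mem8, unfolded lin_simps]
            by (elim disjE conjE, use C1(7) X(7) h1 in linarith,
                use C1(1,5) C2(1,4) sum0[of d1] sum0[of d2] X(1) h2 in linarith,
                use C1(1,7) C2(5) R(1) sorted(1,2) X(7) sum0[of x] X2(1) h6 h7 in linarith,
                use X2(4) h7 in linarith,
                use C1(1) C2(1,5) C3(2) sum0[of d2] R(4) X(4) X2(6) sum0[of x2] h1 h2 in linarith,
                use C3(7) R(3) X2(6) h6 in linarith,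
                use C2(1) C3(3) sum0[of d1] R(1) X(6) X2(4) sum0[of x2] h1 h2 in linarith,
                use C1(7) X(7) h1 in linarith,
                use C1(1,5) C3(2) sum0[of d1] R(4) sorted(2) X(1) sum0[of x] X2(1,7) h2 h6 h7 in linarith)
        qed
        show False
          using far[OF mem7, unfolded lin_simps]
          by (elim disjE conjE, use X(3) in linarith,
              use C1(1,5) C2(1) C3(1) sum0[of d1] sum0[of d2] R(4) sorted(2) X(1) X2(1) h2 in linarith,
              use C1(7) C2(2) sum0[of d2] X(2) in linarith, use X(3) in linarith, use n7 in linarith,
              use C2(2) h6 in linarith, use C2(1) X(6) in linarith, use C1(7) X(7) in linarith,
              use C1(1,5) C3(1) sum0[of d1] R(4) sorted(2) X(8) X2(1) h2 in linarith)
      qed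
      show False
        using far[OF mem3, unfolded lin_simps]
        by (elim disjE conjE, use X(5) in linarith, use C2(5) C3(2) R(4) X(2) in linarith,
            use C1(1) C2(1) C3(1) sum0[of d2] R(4) X(1) X2(1) h2 in linarith,
            use C1(1) C2(1) sum0[of d2] X(4) X2(1) h2 in linarith, use C2(5) X(3) in linarith,
            use n6 in linarith, use X(5) in linarith, use C3(1) R(4) X(8) in linarith, use n3 in linarith)
    qed
    have n8: "\<not> 2 \<le> c d2 - c x2"
    proof
      assume h8: "2 \<le> c d2 - c x2"
      have mem9: "x2 \<in> L" by (intro L_closed L L_x2)
      show False
        using far[OF mem9, unfolded lin_simps]
        by (elim disjE conjE, use C1(7) h1 in linarith, use C1(2) C2(7) X2(2) in linarith,
            use C1(1,7) C2(2) X2(4) sum0[of x2] h1 h8 in linarith, use C1(1) X2(4) in linarith,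
            use C1(2) C2(2) C3(2) R(4) X2(2) sum0[of x2] h1 h8 in linarith, use C2(2) h8 in linarith,
            use X2(5) in linarith, use C1(7) h1 in linarith, use C2(7) X2(7) in linarith)
    qed
    show False
      using far[OF mem2, unfolded lin_simps]
      by (elim disjE conjE, use sum0[of d2] X2(7) sum0[of x2] in linarith, use n2 in linarith,
          use C1(2,5) C2(7) C3(2) sum0[of d1] R(1,4) sorted(1) X2(2) in linarith,
          use C3(5) R(2) X2(3) in linarith, use C1(1) C2(5) X2(4) in linarith, use n8 in linarith,
          use C2(1) X2(6) in linarith, use X2(7) in linarith, use C3(2) R(4) h1 in linarith)
  qed
  have n9: "\<not> 2 \<le> b d1 + b x2"
  proof
    assume h9: "2 \<le> b d1 + b x2"
    have mem10: "x2 \<in> L" by (intro L_closed L L_x2)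
    have n10: "\<not> 2 \<le> c x2"
    proof
      assume h10: "2 \<le> c x2"
      have mem11: "d2 - x2 \<in> L" by (intro L_closed L L_x2)
      have n11: "\<not> 2 \<le> a d2 - a x2"
      proof
        assume h11: "2 \<le> a d2 - a x2"
        have mem12: "x \<in> L" by (intro L_closed L L_x)
        have n12: "\<not> d x \<le> - 2"
        proof
          assume h12: "d x \<le> - 2"
          have mem13: "d1 + d2 + d2 - x \<in> L" by (intro L_closed L L_x)
          have n13: "\<not> 2 \<le> a d1 + 2 * a d2 - a x"
          proof
            assume h13: "2 \<le> a d1 + 2 * a d2 - a x"
            have mem14: "d1 + d2 - x + x2 \<in> L" by (intro L_closed L L_x L_x2)
            show False
              using far[OF mem14, unfolded lin_simps]
              by (elim disjE conjE, use C1(5) C2(1) X(6) h10 in linarith,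
                  use C1(1,5) C2(1,4) sum0[of d1] sum0[of d2] X(1) h11 in linarith,
                  use C1(1) C2(1,5) sum0[of d2] X2(1) h13 in linarith,
                  use C1(1,5) C2(1,4) C3(2) sum0[of d1] sum0[of d2] R(4) X(6) sum0[of x] X2(4) h12 h13 in linarith,
                  use X(4) h9 in linarith,
                  use C1(1) C2(4) C3(2) sum0[of d1] sum0[of d2] R(4) X(4) sum0[of x] X2(6) h12 h13 in linarith,
                  use C1(5) C2(1) X(6) h10 in linarith,
                  use C1(7) C3(1) R(4) X(7) X2(1) sum0[of x2] h9 h10 in linarith,
                  use C1(1,5) C3(2) sum0[of d1] R(4) sorted(2) X2(1,7) h11 h12 in linarith)
          qed
          have n14: "\<not> 2 \<le> c d1 + 2 * c d2 - c x"
          proof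
            assume h14: "2 \<le> c d1 + 2 * c d2 - c x"
            have mem15: "d1 + d2 - x \<in> L" by (intro L_closed L L_x)
            show False
              using far[OF mem15, unfolded lin_simps]
              by (elim disjE conjE, use sum0[of d3] R(1,2,3,4) X(7) sum0[of x] in linarith,
                  use C1(1) C2(2) C3(2) sum0[of d1] sum0[of d2] R(4) X(4) sum0[of x] h12 h14 in linarith,
                  use C1(7) C2(5) C3(7) sum0[of d1] sum0[of d2] R(1,3) sorted(1,2) X(2) X2(1) h11 in linarith,
                  use C2(5) C3(2,7) sum0[of d2] R(3,4) X(2) sum0[of x] X2(1) h11 h12 h14 in linarith,
                  use C1(1) X(4) in linarith, use C3(7) R(3) X(5) in linarith, use C2(2) h14 in linarith,
                  use X(7) in linarith, use C3(2) R(4) h12 in linarith)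
          qed
          show False
            using far[OF mem13, unfolded lin_simps]
            by (elim disjE conjE, use C1(7) C3(1) R(4) X(7) in linarith, use n13 in linarith,
                use C1(7) C2(5) C3(7) sum0[of d1] sum0[of d2] R(1,3) sorted(1) X(2) X2(1) h11 in linarith,
                use C2(1) sum0[of d2] X(3) X2(1) h11 in linarith, use C1(1) C2(5) X(4) in linarith,
                use n14 in linarith, use C1(5) C2(1) X(6) in linarith, use C1(7) C3(1) R(4) X(7) in linarith,
                use C1(1,5) C3(2) sum0[of d1] R(4) sorted(2) X2(1) h11 h12 in linarith)
        qed
        have n15: "\<not> 2 \<le> c x"
        proof
          assume h15: "2 \<le> c x"
          have mem16: "d2 - x \<in> L" by (intro L_closed L L_x)
          have n16: "\<not> b d2 - b x \<le> - 2"
          proof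
            assume h16: "b d2 - b x \<le> - 2"
            have mem17: "d1 + d2 - x + x2 \<in> L" by (intro L_closed L L_x L_x2)
            show False
              using far[OF mem17, unfolded lin_simps]
              by (elim disjE conjE, use C1(5) C2(1) X(6) h10 in linarith,
                  use C1(1,5) C2(1,4) sum0[of d1] sum0[of d2] X(1) h11 in linarith,
                  use C1(1,7) C2(5) R(1) sorted(1,2) X(7) sum0[of x] X2(1) h15 h16 in linarith,
                  use X2(4) h16 in linarith, use X(4) h9 in linarith, use C3(7) R(3) X2(6) h15 in linarith,
                  use C1(5) C2(1) X(6) h10 in linarith,
                  use C1(7) C3(1) R(4) X(7) X2(1) sum0[of x2] h9 h10 in linarith,
                  use C1(1,5) C3(2) sum0[of d1] R(4) sorted(2) X(1) sum0[of x] X2(1,7) h11 h15 h16 in linarith)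
          qed
          show False
            using far[OF mem16, unfolded lin_simps]
            by (elim disjE conjE, use X(3) in linarith,
                use C1(1,5) C2(1) C3(1) sum0[of d1] sum0[of d2] R(4) sorted(2) X(1) X2(1) h11 in linarith,
                use C1(7) C2(2) sum0[of d2] X(2) in linarith, use X(3) in linarith, use n16 in linarith,
                use C2(2) h15 in linarith, use C2(1) X(6) in linarith, use C1(7) X(7) in linarith,
                use C1(1,5) C3(1) sum0[of d1] R(4) sorted(2) X(8) X2(1) h11 in linarith)
        qed
        show False
          using far[OF mem12, unfolded lin_simps]
          by (elim disjE conjE, use X(5) in linarith, use C2(5) C3(2) R(4) X(2) in linarith,
              use C1(1) C2(1) C3(1) sum0[of d2] R(4) X(1) X2(1) h11 in linarith,
              use C1(1) C2(1) sum0[of d2] X(4) X2(1) h11 in linarith, use C2(5) X(3) in linarith,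
              use n15 in linarith, use X(5) in linarith, use C3(1) R(4) X(8) in linarith, use n12 in linarith)
      qed
      show False
        using far[OF mem11, unfolded lin_simps]
        by (elim disjE conjE, use C3(5) R(2) h9 in linarith, use n11 in linarith,
            use C1(2,5) C2(7) C3(2) sum0[of d1] R(1,4) sorted(1) X2(7) sum0[of x2] h9 h10 in linarith,
            use C3(5) R(2) h9 in linarith, use C1(1) C2(5) X2(4) in linarith, use C2(2) h10 in linarith,
            use C2(1) X2(6) in linarith, use X2(7) in linarith, use X2(1) sum0[of x2] h9 h10 in linarith)
    qed
    have n17: "\<not> a x2 \<le> - 2"
    proof
      assume h17: "a x2 \<le> - 2"
      have mem18: "x \<in> L" by (intro L_closed L L_x)
      have n18: "\<not> d x \<le> - 2"
      proof
        assume h18: "d x \<le> - 2"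
        have mem19: "d1 + d2 + d2 - x \<in> L" by (intro L_closed L L_x)
        have n19: "\<not> 2 \<le> a d1 + 2 * a d2 - a x"
        proof
          assume h19: "2 \<le> a d1 + 2 * a d2 - a x"
          have mem20: "d1 + d1 + d2 + d2 - x + x2 \<in> L" by (intro L_closed L L_x L_x2)
          have n20: "\<not> 2 * d d1 + 2 * d d2 - d x + d x2 \<le> - 2"
          proof
            assume h20: "2 * d d1 + 2 * d d2 - d x + d x2 \<le> - 2"
            have mem21: "d1 + d2 - x + x2 \<in> L" by (intro L_closed L L_x L_x2)
            have n21: False if h21: "a d1 + a d2 - a x + a x2 = 0" "b d1 + b d2 - b x + b x2 = 0" "c d1 + c d2 - c x + c x2 = 0" "d d1 + d d2 - d x + d x2 = 0"
            proof -
              \<comment> \<open>In this branch \<open>x2 = x - d1 - d2\<close>. The new hole has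
                equal depth m from 0, \<open>d1 + d2 + d2 - x\<close>, \<open>d1 + d2 - x\<close>
                and \<open>d1 + d2\<close>, for \<open>a\<close>, \<open>b\<close>,
                \<open>c\<close>, \<open>d\<close>, and 4m =
                \<open>a (d1 + d2 - x) - b d2 - d x\<close>. The bound on \<open>a x2\<close> from
                the second hole with \<open>h17\<close> gives \<open>a d2 + b d2 < -4/3\<close>;
                with \<open>h19\<close> and \<open>h18\<close> this makes 4m > 2 + 4/3 + 2, so m >
                4/3.\<close>
              have "\<exists>x3. x3 \<in> L \<and> near (- 1/4 * b d1 - 1/2 * b d2 + 1/4 * b x - 1/4 * c d1 - 1/4 * c d2 + 1/4 * c x - 1/4 * d d1 - 1/4 * d d2)
                  (3/4 * b d1 + 3/2 * b d2 - 3/4 * b x - 1/4 * c d1 - 1/4 * c d2 + 1/4 * c x - 1/4 * d d1 - 1/4 * d d2)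
                  (3/4 * c d1 + 3/4 * c d2 - 3/4 * c x - 1/4 * b d1 - 1/2 * b d2 + 1/4 * b x - 1/4 * d d1 - 1/4 * d d2)
                  (3/4 * d d1 + 3/4 * d d2 - 1/4 * b d1 - 1/2 * b d2 + 1/4 * b x - 1/4 * c d1 - 1/4 * c d2 + 1/4 * c x) x3"
                by (rule cover') linarith
              then obtain x3 where L_x3: "x3 \<in> L" and near_x3: "near (- 1/4 * b d1 - 1/2 * b d2 + 1/4 * b x - 1/4 * c d1 - 1/4 * c d2 + 1/4 * c x - 1/4 * d d1 - 1/4 * d d2)
                  (3/4 * b d1 + 3/2 * b d2 - 3/4 * b x - 1/4 * c d1 - 1/4 * c d2 + 1/4 * c x - 1/4 * d d1 - 1/4 * d d2)
                  (3/4 * c d1 + 3/4 * c d2 - 3/4 * c x - 1/4 * b d1 - 1/2 * b d2 + 1/4 * b x - 1/4 * d d1 - 1/4 * d d2)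
                  (3/4 * d d1 + 3/4 * d d2 - 1/4 * b d1 - 1/2 * b d2 + 1/4 * b x - 1/4 * c d1 - 1/4 * c d2 + 1/4 * c x) x3" by blast
              note X3 = nearD[OF near_x3]
              have mem22: "d1 + d2 - x - x3 \<in> L" by (intro L_closed L L_x L_x3)
              have n22: "\<not> c d1 + c d2 - c x - c x3 \<le> - 2"
              proof
                assume h22: "c d1 + c d2 - c x - c x3 \<le> - 2"
                have mem23: "d1 + d2 + d2 - x - x3 \<in> L" by (intro L_closed L L_x L_x3)
                have n23: "\<not> b d1 + 2 * b d2 - b x - b x3 \<le> - 2"
                proof
                  assume h23: "b d1 + 2 * b d2 - b x - b x3 \<le> - 2"
                  have mem24: "d1 + d2 - x3 \<in> L" by (intro L_closed L L_x3)
                  show False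
                    using far[OF mem24, unfolded lin_simps]
                    by (elim disjE conjE,
                        use C1(1) C2(1) sum0[of d1] sum0[of d2] sum0[of x] X2(1) h17 h18 h19 X3(7) in linarith,
                        use C1(1,4) C2(1) C3(3) sum0[of d2] R(1) X2(1) sum0[of x2] h17 h18 h21(2,3,4) X3(1) in linarith,
                        use sum0[of d1] sum0[of d2] R(1) sorted(1,2) X(4,6) X3(7) sum0[of x3] h22 h23 in linarith,
                        use X(4) h23 in linarith,
                        use C1(4) C2(4) sum0[of d1] sum0[of d2] X(6) h9 h21(2) X3(4) in linarith,
                        use X(6) h22 in linarith,
                        use C1(1,4) C2(1) C3(3) sum0[of d1] sum0[of d2] R(1) X(4) sum0[of x] X2(1) h17 h18 h21(1) X3(6) in linarith,
                        use C2(1,7) sum0[of d1] sum0[of d2] sum0[of x] h18 h19 X3(7) in linarith,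
                        use C1(1,4) C2(1,5) sum0[of d1] X(4,6) X2(1) h17 X3(1) sum0[of x3] h22 h23 in linarith)
                qed
                show False
                  using far[OF mem23, unfolded lin_simps]
                  by (elim disjE conjE, use C1(1) X2(1) h17 h18 h19 X3(3) sum0[of x3] h22 in linarith,
                      use C1(1) C2(1,5) sum0[of d2] sum0[of d3] R(1,2,3,4) sum0[of x] X2(1) sum0[of x2] h17 h18 h21(2,3,4) X3(1) in linarith,
                      use C1(4) sum0[of d1] sum0[of d2] X(4,6) h17 h19 h21(1) X3(2) in linarith,
                      use C2(1,7) sum0[of d1] sum0[of d2] sum0[of x] h18 h19 X3(3) in linarith,
                      use n23 in linarith, use C2(2) h22 in linarith,
                      use C1(4) C2(1,4) sum0[of d1] sum0[of d2] X(4,6) X3(6) in linarith,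
                      use C1(7) C2(1) sum0[of d1] sum0[of d2] X(7) sum0[of x] h19 X3(7) in linarith,
                      use C1(1) C2(5) sum0[of d1] sum0[of d2] sum0[of x] X2(1) h17 h18 h21(1) X3(8) in linarith)
              qed
              show False
                using far[OF mem22, unfolded lin_simps]
                by (elim disjE conjE,
                    use C1(1) C2(1) sum0[of d2] X2(1) h17 h18 h19 X3(5) sum0[of x3] in linarith,
                    use C1(1,4) C2(1) sum0[of d2] X(1,6) sum0[of x] X2(1,4) sum0[of x2] h18 h19 h20 h21(1,2,3) X3(1) in linarith,
                    use C2(5) C3(2) sum0[of d1] sum0[of d2] R(4) X(7) sum0[of x] h17 h21(1) X3(2) in linarith,
                    use C2(5) sum0[of x2] h17 h18 h21(2,3,4) X3(3) in linarith,
                    use C1(1,4) C2(1) C3(2) sum0[of d1] sum0[of d2] R(4) X(4,6,7) sum0[of x] X2(1) h19 h21(1) X3(4) in linarith,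
                    use C2(1,7) sum0[of d1] sum0[of d2] sum0[of x] h18 h19 X3(5) in linarith,
                    use n22 in linarith,
                    use C1(1,4) C2(1) sum0[of d2] X(1,7) X2(1) sum0[of x2] h17 h19 h21(1,2,3,4) X3(7) in linarith,
                    use C1(1,5) C2(1,5) X(1) sum0[of x] h18 X3(8) in linarith)
            qed
            show False
              using far[OF mem21, unfolded lin_simps]
              by (elim disjE conjE, use n21 in blast,
                  use C1(1,5) C2(1) sum0[of d1] sum0[of d2] X(1) h17 in linarith,
                  use C1(1) C2(1,5) sum0[of d2] X2(1) h19 in linarith,
                  use C1(1,4) C2(1,5) sum0[of d2] X(6) sum0[of x] X2(1,4) h17 h18 h19 in linarith,
                  use X(4) h9 in linarith,
                  use C1(1,7) C2(1,5) sum0[of d1] sum0[of d2] X(4) sum0[of x] X2(1,6) h17 h18 h19 in linarith,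
                  use C1(1,4) C2(1) C3(2) sum0[of d1] R(4) X(6) X2(1,4) sum0[of x2] h17 h18 h20 in linarith,
                  use C3(2) R(4) h20 in linarith, use C1(1) C3(2) R(4) X2(1,7) h17 h18 in linarith)
          qed
          show False
            using far[OF mem20, unfolded lin_simps]
            by (elim disjE conjE, use C1(1) C2(1,5) C3(1) sum0[of d2] R(4) X(1,7) X2(1,8) h19 in linarith,
                use C1(1,4,5) C2(1,5) sum0[of d1] sum0[of d2] X(1) X2(1) h17 in linarith,
                use C1(1) C2(1,5) C3(1) sum0[of d2] R(4) sorted(2) X(1) X2(1) h19 in linarith,
                use C1(1,4) C2(1) sum0[of d2] X(6) sum0[of x] X2(1,4) h17 h18 h19 in linarith,
                use C1(1) C2(5) X(4) h9 in linarith,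
                use C1(1,7) C2(1,5) sum0[of d1] sum0[of d2] X(1,4) sum0[of x] X2(1,6) h17 h18 h19 in linarith,
                use C1(5) C2(1) X(6) X2(5) in linarith, use C1(7) C3(1) R(4) X(7) X2(8) in linarith,
                use n20 in linarith)
        qed
        have n24: "\<not> 2 \<le> c d1 + 2 * c d2 - c x"
        proof
          assume h24: "2 \<le> c d1 + 2 * c d2 - c x"
          have mem25: "d1 + d2 - x \<in> L" by (intro L_closed L L_x)
          show False
            using far[OF mem25, unfolded lin_simps]
            by (elim disjE conjE, use sum0[of d1] sum0[of d2] X(7) sum0[of x] in linarith,
                use C1(1,4) sum0[of d1] sum0[of d2] X(1,4) sum0[of x] X2(1) h17 h18 h24 in linarith,
                use C1(7) C2(5) C3(7) sum0[of d1] sum0[of d2] R(1,3) sorted(1,2) X(2) X2(1) h17 in linarith,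
                use C1(7) C2(2) C3(7) R(3) X(2) sum0[of x] X2(1) h17 h18 h24 in linarith,
                use C1(1) X(4) in linarith, use C3(7) R(3) X(5) in linarith, use C2(2) h24 in linarith,
                use X(7) in linarith, use C3(2) R(4) h18 in linarith)
        qed
        show False
          using far[OF mem19, unfolded lin_simps]
          by (elim disjE conjE, use C1(7) C3(1) R(4) X(7) in linarith, use n19 in linarith,
              use C1(7) C2(2,5) C3(7) sum0[of d1] sum0[of d2] R(1,3) sorted(1) X(2) X2(1) h17 in linarith,
              use C1(4) C2(1) sum0[of d2] R(1) sorted(1) X(3) X2(1) h17 in linarith,
              use C1(1) C2(5) X(4) in linarith, use n24 in linarith, use C1(5) C2(1) X(6) in linarith,
              use C1(7) C3(1) R(4) X(7) in linarith, use C1(1) C3(2) R(4) X2(1) h17 h18 in linarith)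
      qed
      have n25: "\<not> 2 \<le> c x"
      proof
        assume h25: "2 \<le> c x"
        have mem26: "d1 + d2 + d2 - x \<in> L" by (intro L_closed L L_x)
        have n26: "\<not> 2 \<le> a d1 + 2 * a d2 - a x"
        proof
          assume h26: "2 \<le> a d1 + 2 * a d2 - a x"
          have mem27: "d2 - x \<in> L" by (intro L_closed L L_x)
          have n27: "\<not> b d2 - b x \<le> - 2"
          proof
            assume h27: "b d2 - b x \<le> - 2"
            have mem28: "d1 + d2 - x + x2 \<in> L" by (intro L_closed L L_x L_x2)
            have n28: False if h28: "a d1 + a d2 - a x + a x2 = 0" "b d1 + b d2 - b x + b x2 = 0" "c d1 + c d2 - c x + c x2 = 0" "d d1 + d d2 - d x + d x2 = 0"
            proof -
              \<comment> \<open>The same expression with all signs reversed, hence with the negated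
                reference vectors. Instead of \<open>d x \<le> -2\<close> there is now
                \<open>d x < -4/3\<close>, from \<open>h25\<close>, \<open>h27\<close> and the bound
                on \<open>a x\<close> from the first hole. The depth exceeds (2 + 4/3 + 4/3)/4 =
                7/6.\<close>
              have "\<exists>x4. x4 \<in> L \<and> near (1/4 * b d1 + 1/2 * b d2 - 1/4 * b x + 1/4 * c d1 + 1/4 * c d2 - 1/4 * c x + 1/4 * d d1 + 1/4 * d d2)
                  (- 3/4 * b d1 - 3/2 * b d2 + 3/4 * b x + 1/4 * c d1 + 1/4 * c d2 - 1/4 * c x + 1/4 * d d1 + 1/4 * d d2)
                  (- 3/4 * c d1 - 3/4 * c d2 + 3/4 * c x + 1/4 * b d1 + 1/2 * b d2 - 1/4 * b x + 1/4 * d d1 + 1/4 * d d2)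
                  (- 3/4 * d d1 - 3/4 * d d2 + 1/4 * b d1 + 1/2 * b d2 - 1/4 * b x + 1/4 * c d1 + 1/4 * c d2 - 1/4 * c x) x4"
                by (rule cover') linarith
              then obtain x4 where L_x4: "x4 \<in> L" and near_x4: "near (1/4 * b d1 + 1/2 * b d2 - 1/4 * b x + 1/4 * c d1 + 1/4 * c d2 - 1/4 * c x + 1/4 * d d1 + 1/4 * d d2)
                  (- 3/4 * b d1 - 3/2 * b d2 + 3/4 * b x + 1/4 * c d1 + 1/4 * c d2 - 1/4 * c x + 1/4 * d d1 + 1/4 * d d2)
                  (- 3/4 * c d1 - 3/4 * c d2 + 3/4 * c x + 1/4 * b d1 + 1/2 * b d2 - 1/4 * b x + 1/4 * d d1 + 1/4 * d d2)
                  (- 3/4 * d d1 - 3/4 * d d2 + 1/4 * b d1 + 1/2 * b d2 - 1/4 * b x + 1/4 * c d1 + 1/4 * c d2 - 1/4 * c x) x4" by blast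
              note X4 = nearD[OF near_x4]
              have mem29: "x4 \<in> L" by (intro L_closed L L_x4)
              have n29: "\<not> 2 \<le> d x4"
              proof
                assume h29: "2 \<le> d x4"
                have mem30: "d1 + d2 + d2 + x4 \<in> L" by (intro L_closed L L_x4)
                have n30: "\<not> 2 \<le> c d1 + 2 * c d2 + c x4"
                proof
                  assume h30: "2 \<le> c d1 + 2 * c d2 + c x4"
                  have mem31: "d1 + d2 + x4 \<in> L" by (intro L_closed L L_x4)
                  have n31: "\<not> 2 \<le> c d1 + c d2 + c x4"
                  proof
                    assume h31: "2 \<le> c d1 + c d2 + c x4"
                    have mem32: "d1 + d1 + d2 + d2 - x + x4 \<in> L" by (intro L_closed L L_x L_x4)
                    show False
                      using far[OF mem32, unfolded lin_simps]
                      by (elim disjE conjE,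
                          use C2(1) sum0[of d1] X(6) X2(1) h17 h26 X4(1,8) h29 h31 in linarith,
                          use C1(1,4,7) C2(1,5) C3(2) sum0[of d1] sum0[of d2] R(4) X(6) X2(1) h27 h28(1) X4(3) sum0[of x4] h29 h31 in linarith,
                          use sum0[of d1] sum0[of d2] R(1) sorted(1,2) X(4,6) h26 X4(1) in linarith,
                          use C1(7) C2(1) sum0[of d1] sum0[of d2] X(1,6) X2(1) h17 h26 h27 X4(1) sum0[of x4] h29 h31 in linarith,
                          use C1(1,4) C2(4) sum0[of d1] sum0[of d2] X(4,6) X4(3) in linarith,
                          use C1(1) sum0[of d1] sum0[of d2] sorted(2) X(1) h17 h25 h26 h27 h28(1) X4(6) in linarith,
                          use C1(5) C2(1) X(6) h31 in linarith,
                          use sum0[of d1] sum0[of d2] R(1) sorted(1,2) X(7) h25 h27 X4(8) in linarith,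
                          use C3(2) R(4) X(1) sum0[of x] h25 h27 h29 in linarith)
                  qed
                  show False
                    using far[OF mem31, unfolded lin_simps]
                    by (elim disjE conjE,
                        use C1(1) sum0[of d1] X(1) sum0[of x] X2(1) sum0[of x2] h9 h17 h25 h26 h28(1,2,3,4) X4(8) h29 h30 in linarith,
                        use C3(3) sum0[of d1] sum0[of d2] R(1) h25 h27 X4(2) in linarith,
                        use C1(1) C2(1) sum0[of d2] X(1) X2(1) h17 h26 X4(1,8) h29 in linarith,
                        use C1(1,4) sum0[of d1] sum0[of d2] X(1,4,6) X2(1) h17 h26 h28(1) X4(1) sum0[of x4] h29 h30 in linarith,
                        use C3(3) sum0[of d1] sum0[of d2] R(1) X(6) h27 X4(3) in linarith, use n31 in linarith,
                        use C2(2) h30 in linarith,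
                        use sum0[of d1] sum0[of d2] R(1) sorted(1,2) h25 h27 X4(8) in linarith,
                        use C3(2) R(4) h29 in linarith)
                qed
                show False
                  using far[OF mem30, unfolded lin_simps]
                  by (elim disjE conjE, use C1(4) C2(1,5) sum0[of d1] X(4) h25 X4(5,8) in linarith,
                      use C1(1,4) C2(1,5) sum0[of d1] sum0[of d2] X2(1) h17 h25 h27 X4(2) in linarith,
                      use C1(1) C2(1) sum0[of d2] X(1) X2(1) h26 h28(1) X4(1,8) h29 in linarith,
                      use C1(1) C2(1) sum0[of d1] sum0[of d2] R(1) sorted(1) X(4) X2(1) h17 h25 h26 h28(1) X4(4) in linarith,
                      use C1(1,4) C2(1,5) sum0[of d1] sum0[of d3] R(1,2,3,4) X(1) X2(1) h9 h17 h28(1,2) X4(3,8) h29 in linarith,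
                      use n30 in linarith,
                      use C2(1) C3(3) sum0[of d1] sum0[of d2] R(1) X(4) h25 X4(5) in linarith,
                      use C1(7) C2(1) C3(1) sum0[of d1] sum0[of d2] R(4) X(1) h25 h26 h27 X4(8) in linarith,
                      use C1(1) C3(2) R(4) X2(1) h17 h29 in linarith)
              qed
              have n32: "\<not> a x4 \<le> - 2"
              proof
                assume h32: "a x4 \<le> - 2"
                have mem33: "d1 + d2 - x + x4 \<in> L" by (intro L_closed L L_x L_x4)
                have n33: "\<not> c d1 + c d2 - c x + c x4 \<le> - 2"
                proof
                  assume h33: "c d1 + c d2 - c x + c x4 \<le> - 2"
                  have mem34: "d1 + d2 + d2 - x + x4 \<in> L" by (intro L_closed L L_x L_x4)
                  show False
                    using far[OF mem34, unfolded lin_simps]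
                    by (elim disjE conjE,
                        use C1(1) C3(1) R(4) X(1) sum0[of x] X2(1) h17 h25 h26 h27 X4(4) sum0[of x4] h33 in linarith,
                        use C1(1) C2(1,5) sum0[of d2] X2(1) h28(1) h32 in linarith,
                        use C1(4) sum0[of d1] sum0[of d2] X(4,6) h17 h26 h28(1) X4(1) in linarith,
                        use sum0[of d1] sum0[of d2] R(1) sorted(1,2) h25 h27 X4(4) in linarith,
                        use C1(1,4) C2(1,5) sum0[of d1] X(4,6) X2(1) h17 X4(8) sum0[of x4] h32 h33 in linarith,
                        use C2(2) h33 in linarith,
                        use C2(1) C3(3) sum0[of d1] sum0[of d2] R(1) X(4,6) X4(5) in linarith,
                        use C1(7) C2(1) sum0[of d1] sum0[of d2] X(7) sum0[of x] h26 X4(8) in linarith,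
                        use C1(1) C2(5) C3(1) R(4) X(1) sum0[of x] X2(1) sum0[of x2] h9 h17 h25 h28(2,3,4) X4(4) sum0[of x4] h32 h33 in linarith)
                qed
                show False
                  using far[OF mem33, unfolded lin_simps]
                  by (elim disjE conjE,
                      use C1(1) C2(1) C3(1) sum0[of d2] R(4) X(1) sum0[of x] X2(1) sum0[of x2] h17 h25 h26 h27 h28(1,2,3,4) X4(6) in linarith,
                      use C1(1,4) C2(1) C3(1) sum0[of d2] R(4) X(1) X2(1) h28(1) h32 in linarith,
                      use C2(5) C3(2) sum0[of d1] sum0[of d2] R(4) X(7) sum0[of x] h17 h28(1) X4(1) in linarith,
                      use C2(5) C3(1) sum0[of d1] sum0[of d2] R(4) X(1) h17 h25 h27 h28(1) X4(4) in linarith,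
                      use C1(1,4) C2(1) C3(2) sum0[of d1] sum0[of d2] R(4) X(4,6,7) sum0[of x] X2(1) h26 h28(1) X4(3) in linarith,
                      use sum0[of d1] sum0[of d2] R(1) sorted(1,2) h25 h27 X4(6) in linarith,
                      use n33 in linarith,
                      use C1(1,4) C2(1) sum0[of d2] X(1,7) X2(1) sum0[of x2] h17 h26 h28(1,2,3,4) X4(8) in linarith,
                      use C1(1,4) C2(1,5) C3(1) sum0[of d1] R(4) X(1) sum0[of x] X2(1) sum0[of x2] h9 h25 h27 h28(3,4) X4(7) in linarith)
              qed
              show False
                using far[OF mem29, unfolded lin_simps]
                by (elim disjE conjE,
                    use C1(1) C2(1) C3(1) sum0[of d1] R(4) X(1) sum0[of x] X2(1) sum0[of x2] h17 h25 h26 h27 h28(1,2,3,4) X4(2) in linarith,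
                    use sum0[of d1] sum0[of d2] R(1) sorted(1,2) h25 h27 X4(2) in linarith, use n32 in linarith,
                    use C1(1) C2(5) C3(1) sum0[of d1] sum0[of d2] R(4) X(1,4) h17 h25 h28(1) X4(4) in linarith,
                    use C1(4) C2(1) sum0[of d1] sum0[of d2] X(6) X2(1) h17 h26 h27 h28(1) X4(3) in linarith,
                    use C1(5) C2(1) C3(1) sum0[of d2] R(4) X(6) X2(1) h26 h27 h28(1) X4(6) in linarith,
                    use C1(1) C2(5) C3(2) sum0[of d1] sum0[of d2] R(4) X(1,4) h17 h25 h28(1) X4(5) in linarith,
                    use n29 in linarith, use C1(1,5) C2(1,5) C3(1) R(4) X(4,6) X4(7) in linarith)
            qed
            show False
              using far[OF mem28, unfolded lin_simps]
              by (elim disjE conjE, use n28 in blast,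
                  use C1(1,5) C2(1) sum0[of d1] sum0[of d2] X(1) h17 in linarith,
                  use C1(1) C2(1,5) sum0[of d2] X2(1) h26 in linarith, use X2(4) h27 in linarith,
                  use X(4) h9 in linarith,
                  use C1(1) C2(5) C3(2) sum0[of d1] sum0[of d2] R(4) sorted(2) X(1) X2(6) h25 h26 in linarith,
                  use C1(4) C2(1) C3(1) sum0[of d1] R(4) X(6) X2(1,5) h17 in linarith,
                  use C1(4) C2(1,5) C3(1) sum0[of d2] R(4) X(1,7) X2(8) h26 in linarith,
                  use C1(1) X(1) sum0[of x] X2(1,7) h17 h25 h27 in linarith)
          qed
          show False
            using far[OF mem27, unfolded lin_simps]
            by (elim disjE conjE, use C1(1,4) C2(1,5) sum0[of d2] X2(1) h17 h26 in linarith,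
                use C1(1) C2(1) C3(1) sum0[of d2] R(4) X(1) X2(1) h17 in linarith,
                use C3(3) R(1) h26 in linarith, use X(3) in linarith, use n27 in linarith,
                use C2(2) h25 in linarith, use C2(1) X(6) in linarith, use C1(7) X(7) in linarith,
                use C1(1) C3(1) R(4) X(8) X2(1) h17 in linarith)
        qed
        have n34: "\<not> d d1 + 2 * d d2 - d x \<le> - 2"
        proof
          assume h34: "d d1 + 2 * d d2 - d x \<le> - 2"
          have mem35: "d2 - x \<in> L" by (intro L_closed L L_x)
          show False
            using far[OF mem35, unfolded lin_simps]
            by (elim disjE conjE, use X(3) in linarith,
                use C1(1) C2(1) C3(1) sum0[of d2] R(4) X(1) X2(1) h17 in linarith,
                use C2(2) C3(2) sum0[of d2] R(4) X(3) sum0[of x] h25 h34 in linarith, use X(3) in linarith,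
                use C1(1) X(1) sum0[of x] X2(1) h17 h25 h34 in linarith, use C2(2) h25 in linarith,
                use C2(1) X(6) in linarith, use C3(2) R(4) h34 in linarith,
                use C1(1) C3(1) R(4) X(8) X2(1) h17 in linarith)
        qed
        show False
          using far[OF mem26, unfolded lin_simps]
          by (elim disjE conjE, use C1(7) C3(1) R(4) X(7) in linarith, use n26 in linarith,
              use C1(7) C2(2,5) C3(7) sum0[of d1] sum0[of d2] R(1,3) sorted(1) X(2) X2(1) h17 in linarith,
              use C1(4) C2(1) sum0[of d2] R(1) sorted(1) X(3) X2(1) h17 in linarith,
              use C1(1) C2(5) X(4) in linarith, use C2(2) C3(7) R(3) h25 in linarith,
              use C1(5) C2(1) X(6) in linarith, use C1(7) C3(1) R(4) X(7) in linarith, use n34 in linarith)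
      qed
      show False
        using far[OF mem18, unfolded lin_simps]
        by (elim disjE conjE, use X(5) in linarith, use C2(5) C3(2) R(4) X(2) in linarith,
            use C1(1,4) C2(1) C3(1) sum0[of d2] R(1,4) sorted(1) X(1) X2(1) h17 in linarith,
            use C1(1,4) C2(1) sum0[of d2] R(1) sorted(1) X(4) X2(1) h17 in linarith, use C2(5) X(3) in linarith,
            use n25 in linarith, use X(5) in linarith, use C3(1) R(4) X(8) in linarith, use n18 in linarith)
    qed
    show False
      using far[OF mem10, unfolded lin_simps]
      by (elim disjE conjE, use X2(5) in linarith, use C1(2) C2(7) X2(2) in linarith, use n17 in linarith,
          use C1(1) X2(4) in linarith, use C1(2) h9 in linarith, use n10 in linarith, use X2(5) in linarith,
          use C1(7) C3(1) R(4) X2(8) in linarith, use C2(7) X2(7) in linarith)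
  qed
  have n35: "\<not> a d1 + a x2 \<le> - 2"
  proof
    assume h35: "a d1 + a x2 \<le> - 2"
    have mem36: "x \<in> L" by (intro L_closed L L_x)
    have n36: "\<not> d x \<le> - 2"
    proof
      assume h36: "d x \<le> - 2"
      have mem37: "d1 + d2 + d2 - x \<in> L" by (intro L_closed L L_x)
      have n37: "\<not> 2 \<le> c d1 + 2 * c d2 - c x"
      proof
        assume h37: "2 \<le> c d1 + 2 * c d2 - c x"
        have mem38: "d1 + d2 - x \<in> L" by (intro L_closed L L_x)
        show False
          using far[OF mem38, unfolded lin_simps]
          by (elim disjE conjE, use sum0[of d3] R(1,2,3,4) X(7) sum0[of x] in linarith,
              use C1(1) sum0[of d1] sum0[of d2] X(1,4) sum0[of x] X2(1) h35 h36 h37 in linarith,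
              use C1(7) C2(5) C3(7) sum0[of d1] sum0[of d2] R(1,3) sorted(1,2) X(2) X2(1) h35 in linarith,
              use C1(7) C2(5) C3(7) sum0[of d1] sum0[of d2] R(1,3) sorted(1,2) X(2) sum0[of x] X2(1) h35 h36 h37 in linarith,
              use C1(1) X(4) in linarith, use C3(7) R(3) X(5) in linarith, use C2(2) h37 in linarith,
              use X(7) in linarith, use C3(2) R(4) h36 in linarith)
      qed
      show False
        using far[OF mem37, unfolded lin_simps]
        by (elim disjE conjE, use C2(1) C3(1) sum0[of d1] R(4) X(6) X2(1) h35 in linarith,
            use C1(1) C2(1,5) C3(1) sum0[of d2] R(4) sorted(2) X(1) X2(1) h35 in linarith,
            use C1(7) C2(5) C3(7) sum0[of d1] sum0[of d2] R(1,3) sorted(1,2) X(2) X2(1) h35 in linarith,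
            use C2(1) sum0[of d2] R(1) sorted(1,2) X(3) X2(1) h35 in linarith, use C1(1) C2(5) X(4) in linarith,
            use n37 in linarith, use C1(5) C2(1) X(6) in linarith, use C1(7) C3(1) R(4) X(7) in linarith,
            use C1(1) C3(2) R(1,4) sorted(1,2) X2(1) h35 h36 in linarith)
    qed
    have n38: "\<not> 2 \<le> c x"
    proof
      assume h38: "2 \<le> c x"
      have mem39: "d2 - x \<in> L" by (intro L_closed L L_x)
      have n39: "\<not> b d2 - b x \<le> - 2"
      proof
        assume h39: "b d2 - b x \<le> - 2"
        have mem40: "d1 + d2 - x \<in> L" by (intro L_closed L L_x)
        show False
          using far[OF mem40, unfolded lin_simps]
          by (elim disjE conjE, use C3(7) R(3) h38 in linarith,
              use C1(1) C2(1) C3(1) sum0[of d2] R(4) X(1) X2(1) h35 in linarith,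
              use C1(7) C2(2) sum0[of d2] R(1) sorted(1,2) X(7) sum0[of x] h38 h39 in linarith,
              use C1(2) h39 in linarith, use C1(1) X(4) in linarith, use C3(7) R(3) h38 in linarith,
              use C2(1) C3(1) sum0[of d1] R(4) X(6) X2(1) h35 in linarith, use X(7) in linarith,
              use X(1) sum0[of x] h38 h39 in linarith)
      qed
      show False
        using far[OF mem39, unfolded lin_simps]
        by (elim disjE conjE, use X(3) in linarith,
            use C1(1) C2(1) C3(1) sum0[of d2] R(1,4) sorted(1,2) X(1) X2(1) h35 in linarith,
            use C1(1,7) C2(5) C3(7) sum0[of d1] sum0[of d2] R(1,3) sorted(1) X(2) X2(1) h35 in linarith,
            use X(3) in linarith, use n39 in linarith, use C2(2) h38 in linarith, use C2(1) X(6) in linarith,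
            use C1(7) X(7) in linarith, use C1(1) C3(1) R(1,4) sorted(1,2) X(8) X2(1) h35 in linarith)
    qed
    show False
      using far[OF mem36, unfolded lin_simps]
      by (elim disjE conjE, use X(5) in linarith,
          use C1(1,7) C2(5) C3(7) sum0[of d1] sum0[of d2] R(3) sorted(2) X(2) X2(1) h35 in linarith,
          use C1(1) C2(1) C3(1) sum0[of d2] R(1,4) sorted(1,2) X(1) X2(1) h35 in linarith,
          use C1(1) C2(1) sum0[of d2] R(1) sorted(1,2) X(4) X2(1) h35 in linarith, use C2(5) X(3) in linarith,
          use n38 in linarith, use X(5) in linarith, use C3(1) R(4) X(8) in linarith, use n36 in linarith)
  qed
  show False
    using far[OF mem1, unfolded lin_simps]
    by (elim disjE conjE, use sum0[of d1] X2(3) sum0[of x2] in linarith,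
        use C1(5) C3(2) sum0[of d1] R(4) X2(2) in linarith, use n35 in linarith, use n9 in linarith,
        use X2(3) in linarith, use C2(1) C3(7) R(3) X2(6) in linarith, use C1(5) X2(5) in linarith,
        use C3(1) R(4) X2(8) in linarith, use n1 in linarith)
qed

lemma facet: "\<exists>v\<in>L. cap a b c d v"
proof -
  have "\<exists>v. v \<in> L \<and> near (7/6) (-7/18) (-7/18) (-7/18) v"
    by (rule cover') simp
  then obtain v where v: "v \<in> L" and near_v: "near (7/6) (-7/18) (-7/18) (-7/18) v"
    by blast
  note V = nearD[OF near_v]
  have "2 \<le> a v"
    using far[OF v] by (elim disjE conjE) (use V in linarith)+
  with V v show ?thesis
    unfolding cap_def by (intro bexI[of _ v] conjI) linarith+
qed

lemma single:
  assumes "h \<in> L" "cap a b c d v" "h + h = v"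
  shows False
proof -
  note C = capD[OF assms(2)]
  have "a h + a h = a v" "b h + b h = b v" "c h + c h = c v" "d h + d h = d v"
    using assms(3) by (metis lin_simps)+
  moreover have "h = 0"
    by (rule pack[OF assms(1)]; unfold abs_less_iff; intro conjI; use calculation C in linarith)
  ultimately show False
    using C(1) lin_simps(13) by simp
qed

lemma pair:
  assumes "h \<in> L" "cap a b c d u" "cap b a c d v" "h + h = u + v"
  shows False
proof -
  note C = capD[OF assms(2)] capD[OF assms(3)]
  have "a h + a h = a u + a v" "b h + b h = b u + b v" "c h + c h = c u + c v" "d h + d h = d u + d v"
    using assms(4) by (metis lin_simps)+
  moreover have "h = 0"
    by (rule pack[OF assms(1)]; unfold abs_less_iff; intro conjI; use calculation C in linarith)
  ultimately show False
    using C(1,11) lin_simps(13) by simp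
qed

end

section \<open>Symmetry under permutations of the facets\<close>

text \<open>The locale assumptions are symmetric in the four functionals. The three adjacent
  transpositions generate all permutations, so each configuration has to be refuted in one labelling
  only.\<close>

lemma octahedral_swap:
  assumes "octahedral L a b c d"
  shows "octahedral L b a c d" "octahedral L a c b d" "octahedral L a b d c"
proof -
  interpret octahedral L a b c d by fact
  show "octahedral L b a c d"
  proof (rule octahedral.intro)
    show "\<exists>v\<in>L. \<bar>p - b v\<bar> < 7/6 \<and> \<bar>q - a v\<bar> < 7/6 \<and> \<bar>r - c v\<bar> < 7/6 \<and> \<bar>s - d v\<bar> < 7/6"
      if "p + q + r + s = 0" for p q r s using cover[of q p r s] that by (simp only: add_ac) blast
    show "b v + a v + c v + d v = 0" for v using sum0[of v] by simp
  qed (rule linear halve | erule (1) diff | (rule pack; assumption))+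
  show "octahedral L a c b d"
  proof (rule octahedral.intro)
    show "\<exists>v\<in>L. \<bar>p - a v\<bar> < 7/6 \<and> \<bar>q - c v\<bar> < 7/6 \<and> \<bar>r - b v\<bar> < 7/6 \<and> \<bar>s - d v\<bar> < 7/6"
      if "p + q + r + s = 0" for p q r s using cover[of p r q s] that by (simp only: add_ac) blast
    show "a v + c v + b v + d v = 0" for v using sum0[of v] by simp
  qed (rule linear halve | erule (1) diff | (rule pack; assumption))+
  show "octahedral L a b d c"
  proof (rule octahedral.intro)
    show "\<exists>v\<in>L. \<bar>p - a v\<bar> < 7/6 \<and> \<bar>q - b v\<bar> < 7/6 \<and> \<bar>r - d v\<bar> < 7/6 \<and> \<bar>s - c v\<bar> < 7/6"
      if "p + q + r + s = 0" for p q r s using cover[of p q s r] that by (simp only: add_ac) blast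
    show "a v + b v + d v + c v = 0" for v using sum0[of v] by simp
  qed (rule linear halve | erule (1) diff | (rule pack; assumption))+
qed

context octahedral
begin

lemmas perm_bacd = octahedral_swap(1)[OF octahedral_axioms]
lemmas perm_acbd = octahedral_swap(2)[OF octahedral_axioms]
lemmas perm_abdc = octahedral_swap(3)[OF octahedral_axioms]
lemmas perm_acdb = octahedral_swap(3)[OF perm_acbd]
lemmas perm_adbc = octahedral_swap(2)[OF perm_abdc]
lemmas perm_adcb = octahedral_swap(3)[OF perm_adbc]
lemmas perm_bcad = octahedral_swap(2)[OF perm_bacd]
lemmas perm_bcda = octahedral_swap(3)[OF perm_bcad]
lemmas perm_cabd = octahedral_swap(1)[OF perm_acbd]
lemmas perm_cadb = octahedral_swap(1)[OF perm_acdb]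
lemmas perm_cdab = octahedral_swap(2)[OF perm_cadb]
lemmas perm_dabc = octahedral_swap(1)[OF perm_adbc]
lemmas perm_dcab = octahedral_swap(1)[OF perm_cdab]
lemmas perm_bdac = octahedral_swap(2)[OF octahedral_swap(3)[OF perm_bacd]]

section \<open>Removing the ordering hypotheses and classifying the half-sums\<close>

lemma planar_triple:
  assumes L: "d1 \<in> L" "d2 \<in> L" "d3 \<in> L" and rel: "d1 + d2 + d3 = 0"
    and caps: "cap b a c d d1" "cap c a b d d2" "cap d a b c d3"
  shows False
proof -
  consider "a d3 \<le> a d2" "a d2 \<le> a d1" | "a d3 \<le> a d1" "a d1 \<le> a d2" | "a d2 \<le> a d3" "a d3 \<le> a d1"
    | "a d2 \<le> a d1" "a d1 \<le> a d3" | "a d1 \<le> a d3" "a d3 \<le> a d2" | "a d1 \<le> a d2" "a d2 \<le> a d3"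
    by linarith
  then show False
  proof cases
    case 1 from planar_triple_ordered[OF L rel caps this] show False .
  next
    case 2 show False
      by (rule octahedral.planar_triple_ordered[OF perm_acbd, of d2 d1 d3]) (use L rel caps 2 in \<open>simp_all add: cap_def add.commute add.left_commute\<close>)
  next
    case 3 show False
      by (rule octahedral.planar_triple_ordered[OF perm_abdc, of d1 d3 d2]) (use L rel caps 3 in \<open>simp_all add: cap_def add.commute add.left_commute\<close>)
  next
    case 4 show False
      by (rule octahedral.planar_triple_ordered[OF perm_adbc, of d3 d1 d2]) (use L rel caps 4 in \<open>simp_all add: cap_def add.commute add.left_commute\<close>)
  next
    case 5 show False
      by (rule octahedral.planar_triple_ordered[OF perm_acdb, of d2 d3 d1]) (use L rel caps 5 in \<open>simp_all add: cap_def add.commute add.left_commute\<close>)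
  next
    case 6 show False
      by (rule octahedral.planar_triple_ordered[OF perm_adcb, of d3 d2 d1]) (use L rel caps 6 in \<open>simp_all add: cap_def add.commute add.left_commute\<close>)
  qed
qed

lemma doubled_top:
  assumes L: "d0 \<in> L" "d1 \<in> L" "d2 \<in> L" "d3 \<in> L" and rel: "d0 + d0 + d1 + d2 + d3 = 0"
    and top: "2 \<le> a d0" "a d0 < 7/3"
    and caps: "cap b a c d d1" "cap c a b d d2" "cap d a b c d3"
  shows False
proof -
  consider "b d0 \<le> c d0" "c d0 \<le> d d0" | "c d0 \<le> b d0" "b d0 \<le> d d0" | "b d0 \<le> d d0" "d d0 \<le> c d0"
    | "d d0 \<le> b d0" "b d0 \<le> c d0" | "c d0 \<le> d d0" "d d0 \<le> b d0" | "d d0 \<le> c d0" "c d0 \<le> b d0"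
    by linarith
  then show False
  proof cases
    case 1 from doubled_top_ordered[OF L rel top caps this] show False .
  next
    case 2 show False
      by (rule octahedral.doubled_top_ordered[OF perm_acbd, of d0 d2 d1 d3]) (use L rel top caps 2 in \<open>simp_all add: cap_def add.commute add.left_commute\<close>)
  next
    case 3 show False
      by (rule octahedral.doubled_top_ordered[OF perm_abdc, of d0 d1 d3 d2]) (use L rel top caps 3 in \<open>simp_all add: cap_def add.commute add.left_commute\<close>)
  next
    case 4 show False
      by (rule octahedral.doubled_top_ordered[OF perm_adbc, of d0 d3 d1 d2]) (use L rel top caps 4 in \<open>simp_all add: cap_def add.commute add.left_commute\<close>)
  next
    case 5 show False
      by (rule octahedral.doubled_top_ordered[OF perm_acdb, of d0 d2 d3 d1]) (use L rel top caps 5 in \<open>simp_all add: cap_def add.commute add.left_commute\<close>)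
  next
    case 6 show False
      by (rule octahedral.doubled_top_ordered[OF perm_adcb, of d0 d3 d2 d1]) (use L rel top caps 6 in \<open>simp_all add: cap_def add.commute add.left_commute\<close>)
  qed
qed

text \<open>The caps bound \<open>b h\<close>, \<open>c h\<close>, \<open>d h\<close> by 35/18 < 2
  in absolute value, and \<open>a h < 7/6\<close>. So either \<open>h = 0\<close> and the three
  vectors sum to zero, or \<open>a h \<le> -2\<close> and \<open>- h\<close> becomes the doubled
  vector.\<close>

lemma triple:
  assumes h: "h \<in> L" and L: "d1 \<in> L" "d2 \<in> L" "d3 \<in> L" and rel: "h + h = d1 + d2 + d3"
    and caps: "cap b a c d d1" "cap c a b d d2" "cap d a b c d3"
  shows False
proof -
  note C = capD[OF caps(1)] capD[OF caps(2)] capD[OF caps(3)]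
  have R: "a h + a h = a d1 + a d2 + a d3" "b h + b h = b d1 + b d2 + b d3"
    "c h + c h = c d1 + c d2 + c d3" "d h + d h = d d1 + d d2 + d d3"
    using rel by (metis lin_simps)+
  show False
  proof (cases "a h \<le> -2")
    case True
    show False
      by (rule doubled_top[of "- h" d1 d2 d3])
        (use h L rel caps negL True C R in \<open>simp_all add: lin_simps algebra_simps\<close>)
  next
    case False
    have "h = 0"
      by (rule pack[OF h]; unfold abs_less_iff; intro conjI; use False C R in linarith)
    with rel show False
      using planar_triple[OF L _ caps] by simp
  qed
qed

text \<open>Rotating the indices 1, 2, 3 preserves the three edges, so \<open>b d0\<close> may be
  taken as the least of the three values at \<open>d0\<close>.\<close>

lemma cyclic_edges:
  assumes L: "d0 \<in> L" "d1 \<in> L" "d2 \<in> L" "d3 \<in> L" and rel: "d0 + d1 + d2 + d3 = 0"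
    and caps: "cap a b c d d0" "cap b a c d d1" "cap c a b d d2" "cap d a b c d3"
    and edges: "2 \<le> c d1 + c d2" "2 \<le> d d2 + d d3" "2 \<le> b d3 + b d1"
  shows False
proof -
  consider "b d0 \<le> c d0" "b d0 \<le> d d0" | "c d0 \<le> d d0" "c d0 \<le> b d0" | "d d0 \<le> b d0" "d d0 \<le> c d0"
    by linarith
  then show False
  proof cases
    case 1 from cyclic_edges_ordered[OF L rel caps edges this] show False .
  next
    case 2 show False
      by (rule octahedral.cyclic_edges_ordered[OF perm_acdb, of d0 d2 d3 d1]) (use L rel caps edges 2 in \<open>simp_all add: cap_def add.commute add.left_commute\<close>)
  next
    case 3 show False
      by (rule octahedral.cyclic_edges_ordered[OF perm_adbc, of d0 d3 d1 d2]) (use L rel caps edges 3 in \<open>simp_all add: cap_def add.commute add.left_commute\<close>)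
  qed
qed

text \<open>Exchanging the indices 1 and 2 preserves the star and reverses the comparison of
  \<open>c d1\<close> with \<open>b d2\<close>.\<close>

lemma star_edges:
  assumes L: "d0 \<in> L" "d1 \<in> L" "d2 \<in> L" "d3 \<in> L" and rel: "d0 + d1 + d2 + d3 = 0"
    and caps: "cap a b c d d0" "cap b a c d d1" "cap c a b d d2" "cap d a b c d3"
    and edges: "2 \<le> b d0 + b d1" "2 \<le> c d0 + c d2" "2 \<le> a d3 + a d0"
  shows False
proof (cases "c d1 \<le> b d2")
  case True from star_edges_ordered[OF L rel caps edges this] show False .
next
  case False show False
    by (rule octahedral.star_edges_ordered[OF perm_acbd, of d0 d2 d1 d3]) (use L rel caps edges False in \<open>simp_all add: cap_def add.commute add.left_commute\<close>)
qed

text \<open>Read \<open>2 \<le> b d0 + b d1\<close> as an edge between 0 and 1 that points to 1. As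
  the four vectors sum to zero, complementary pairs have opposite sums, so by packing each of the
  three splittings of the indices into two pairs supplies such an edge. No two of the chosen edges
  point to the same index, and they cannot all leave one common index. The five remaining
  combinations are stars with one edge pointing to the centre, or directed triangles.\<close>

lemma edge_01:
  assumes L: "d0 \<in> L" "d1 \<in> L" "d2 \<in> L" "d3 \<in> L" and rel: "d0 + d1 + d2 + d3 = 0"
    and caps: "cap a b c d d0" "cap b a c d d1" "cap c a b d d2" "cap d a b c d3"
    and e01: "2 \<le> b d0 + b d1"
  shows False
proof -
  note C = capD[OF caps(1)] capD[OF caps(2)] capD[OF caps(3)] capD[OF caps(4)]
  have R: "a d0 + a d1 + a d2 + a d3 = 0" "b d0 + b d1 + b d2 + b d3 = 0"
    "c d0 + c d1 + c d2 + c d3 = 0" "d d0 + d d1 + d d2 + d d3 = 0"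
    using rel by (metis lin_simps)+
  note S = sum0[of d0] sum0[of d1] sum0[of d2] sum0[of d3]
  have "2 \<le> c d0 + c d2 \<or> 2 \<le> a d2 + a d0 \<or> 2 \<le> d d1 + d d3"
    using far[OF addL[OF L(1,3)], unfolded lin_simps] by (elim disjE conjE) (use C R e01 in linarith)+
  moreover have "2 \<le> d d0 + d d3 \<or> 2 \<le> a d3 + a d0 \<or> 2 \<le> c d1 + c d2"
    using far[OF addL[OF L(1,4)], unfolded lin_simps] by (elim disjE conjE) (use C R e01 in linarith)+
  \<comment> \<open>All three edges would leave 0 and add up to at least 6; but
    \<open>b d0 + c d0 + d d0 = - a d0 \<le> -2\<close> and
    \<open>b d1 + c d2 + d d3 < 7\<close>.\<close>
  moreover have "\<not> (2 \<le> c d0 + c d2 \<and> 2 \<le> d d0 + d d3)" using C S e01 by linarith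
  \<comment> \<open>Two edges pointing to the same index: adding them and using the relation gives
    \<open>c d2 - c d3 \<ge> 4\<close>, above the cap bound 7/3 + 14/9 = 35/9. The next two
    exclusions are of the same kind.\<close>
  moreover have "\<not> (2 \<le> c d0 + c d2 \<and> 2 \<le> c d1 + c d2)" using C R by linarith
  moreover have "\<not> (2 \<le> a d2 + a d0 \<and> 2 \<le> a d3 + a d0)" using C R by linarith
  moreover have "\<not> (2 \<le> d d1 + d d3 \<and> 2 \<le> d d0 + d d3)" using C R by linarith
  ultimately consider "2 \<le> c d0 + c d2" "2 \<le> a d3 + a d0" | "2 \<le> a d2 + a d0" "2 \<le> d d0 + d d3"
    | "2 \<le> a d2 + a d0" "2 \<le> c d1 + c d2" | "2 \<le> d d1 + d d3" "2 \<le> a d3 + a d0"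
    | "2 \<le> d d1 + d d3" "2 \<le> c d1 + c d2"
    by blast
  then show False
  proof cases
    case 1 from star_edges[OF L rel caps e01 this] show False .
  next
    case 2 show False
      by (rule octahedral.star_edges[OF perm_abdc, of d0 d1 d3 d2]) (use L rel caps e01 2 in \<open>simp_all add: cap_def add.commute add.left_commute\<close>)
  next
    case 3 show False
      by (rule octahedral.cyclic_edges[OF perm_dabc, of d3 d0 d1 d2]) (use L rel caps e01 3 in \<open>simp_all add: cap_def add.commute add.left_commute\<close>)
  next
    case 4
    have rel': "d2 + d0 + d1 + d3 = 0" using rel by (simp add: add_ac)
    show False
      by (rule octahedral.cyclic_edges[OF perm_cabd L(3,1,2,4) rel'])
        (use e01 4 in linarith | use caps in \<open>simp add: cap_def\<close>)+
  next
    case 5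
    have rel': "d1 + d2 + d3 + d0 = 0" using rel by (simp add: add_ac)
    show False
      by (rule octahedral.star_edges[OF perm_bcda L(2,3,4,1) rel'])
        (use e01 5 in linarith | use caps in \<open>simp add: cap_def\<close>)+
  qed
qed

text \<open>The sum \<open>d0 + d1\<close> is nonzero, hence long. The caps leave only its own two
  facets, or those of the complementary pair through \<open>d2 + d3 = - (d0 + d1)\<close>;
  relabelling makes the resulting edge point from 0 to 1.\<close>

lemma superbase:
  assumes L: "d0 \<in> L" "d1 \<in> L" "d2 \<in> L" "d3 \<in> L" and rel: "d0 + d1 + d2 + d3 = 0"
    and caps: "cap a b c d d0" "cap b a c d d1" "cap c a b d d2" "cap d a b c d3"
  shows False
proof -
  note C = capD[OF caps(1)] capD[OF caps(2)] capD[OF caps(3)] capD[OF caps(4)]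
  have R: "a d0 + a d1 + a d2 + a d3 = 0" "b d0 + b d1 + b d2 + b d3 = 0"
    "c d0 + c d1 + c d2 + c d3 = 0" "d d0 + d d1 + d d2 + d d3 = 0"
    using rel by (metis lin_simps)+
  have "2 \<le> b d0 + b d1 \<or> 2 \<le> a d1 + a d0 \<or> 2 \<le> c d3 + c d2 \<or> 2 \<le> d d2 + d d3"
    using far[OF addL[OF L(1,2)], unfolded lin_simps] by (elim disjE conjE) (use C R in linarith)+
  then consider "2 \<le> b d0 + b d1" | "2 \<le> a d1 + a d0" | "2 \<le> c d3 + c d2" | "2 \<le> d d2 + d d3"
    by blast
  then show False
  proof cases
    case 1 from edge_01[OF L rel caps this] show False .
  next
    case 2 show False
      by (rule octahedral.edge_01[OF perm_bacd, of d1 d0 d2 d3]) (use L rel caps 2 in \<open>simp_all add: cap_def add.commute add.left_commute\<close>)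
  next
    case 3 show False
      by (rule octahedral.edge_01[OF perm_dcab, of d3 d2 d0 d1]) (use L rel caps 3 in \<open>simp_all add: cap_def add.commute add.left_commute\<close>)
  next
    case 4 show False
      by (rule octahedral.edge_01[OF perm_cdab, of d2 d3 d0 d1]) (use L rel caps 4 in \<open>simp_all add: cap_def add.commute add.left_commute\<close>)
  qed
qed

text \<open>The caps keep every value of \<open>h\<close> above -4/3, so \<open>h\<close> can be
  long only through a value that is at least 2; otherwise \<open>h = 0\<close>.\<close>

lemma quadruple:
  assumes h: "h \<in> L" and L: "d0 \<in> L" "d1 \<in> L" "d2 \<in> L" "d3 \<in> L" and rel: "h + h = d0 + d1 + d2 + d3"
    and caps: "cap a b c d d0" "cap b a c d d1" "cap c a b d d2" "cap d a b c d3"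
  shows False
proof -
  note C = capD[OF caps(1)] capD[OF caps(2)] capD[OF caps(3)] capD[OF caps(4)]
  have R: "a h + a h = a d0 + a d1 + a d2 + a d3" "b h + b h = b d0 + b d1 + b d2 + b d3"
    "c h + c h = c d0 + c d1 + c d2 + c d3" "d h + d h = d d0 + d d1 + d d2 + d d3"
    using rel by (metis lin_simps)+
  consider "2 \<le> a h" | "2 \<le> b h" | "2 \<le> c h" | "2 \<le> d h" | "a h < 2" "b h < 2" "c h < 2" "d h < 2"
    by linarith
  then show False
  proof cases
    case 1 show False
      by (rule quadruple_top[of d0 d1 d2 d3 h]) (use h L rel caps 1 in simp_all)
  next
    case 2 show False
      by (rule octahedral.quadruple_top[OF perm_bacd, of d1 d0 d2 d3 h]) (use h L rel caps 2 in \<open>simp_all add: cap_def add.commute add.left_commute\<close>)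
  next
    case 3 show False
      by (rule octahedral.quadruple_top[OF perm_cabd, of d2 d0 d1 d3 h]) (use h L rel caps 3 in \<open>simp_all add: cap_def add.commute add.left_commute\<close>)
  next
    case 4 show False
      by (rule octahedral.quadruple_top[OF perm_dabc, of d3 d0 d1 d2 h]) (use h L rel caps 4 in \<open>simp_all add: cap_def add.commute add.left_commute\<close>)
  next
    case 5
    have "h = 0"
      by (rule pack[OF h]; unfold abs_less_iff; intro conjI; use 5 C R in linarith)
    with rel show False
      using superbase[OF L _ caps] by simp
  qed
qed

theorem contradiction: False
proof -
  obtain d0 d1 d2 d3 where L: "d0 \<in> L" "d1 \<in> L" "d2 \<in> L" "d3 \<in> L"
    and caps: "cap a b c d d0" "cap b a c d d1" "cap c a b d d2" "cap d a b c d3"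
    using facet octahedral.facet[OF perm_bacd] octahedral.facet[OF perm_cabd] octahedral.facet[OF perm_dabc] by blast
  obtain h where h: "h \<in> L" and "h + h \<in> {d0, d1, d2, d3, d0 + d1, d0 + d2, d0 + d3, d1 + d2, d1 + d3, d2 + d3,
      d0 + d1 + d2, d0 + d1 + d3, d0 + d2 + d3, d1 + d2 + d3, d0 + d1 + d2 + d3}"
    using halve[of d0 d1 d2 d3] L by auto
  then consider "h + h = d0" | "h + h = d1" | "h + h = d2" | "h + h = d3"
    | "h + h = d0 + d1" | "h + h = d0 + d2" | "h + h = d0 + d3" | "h + h = d1 + d2" | "h + h = d1 + d3" | "h + h = d2 + d3"
    | "h + h = d0 + d1 + d2" | "h + h = d0 + d1 + d3" | "h + h = d0 + d2 + d3" | "h + h = d1 + d2 + d3"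
    | "h + h = d0 + d1 + d2 + d3"
    by blast
  then show False
  proof cases
    case 1 then show False using single[OF h caps(1)] by blast
  next
    case 2 then show False using octahedral.single[OF perm_bacd h caps(2)] by blast
  next
    case 3 then show False using octahedral.single[OF perm_cabd h caps(3)] by blast
  next
    case 4 then show False using octahedral.single[OF perm_dabc h caps(4)] by blast
  next
    case 5 then show False using pair[OF h caps(1,2)] by blast
  next
    case 6 show False
      by (rule octahedral.pair[OF perm_acbd h _ _ 6]) (use caps in \<open>simp_all add: cap_def\<close>)
  next
    case 7 show False
      by (rule octahedral.pair[OF perm_adbc h _ _ 7]) (use caps in \<open>simp_all add: cap_def\<close>)
  next
    case 8 show False
      by (rule octahedral.pair[OF perm_bcad h _ _ 8]) (use caps in \<open>simp_all add: cap_def\<close>)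
  next
    case 9 show False
      by (rule octahedral.pair[OF perm_bdac h _ _ 9]) (use caps in \<open>simp_all add: cap_def\<close>)
  next
    case 10 show False
      by (rule octahedral.pair[OF perm_cdab h _ _ 10]) (use caps in \<open>simp_all add: cap_def\<close>)
  next
    case 11 show False
      by (rule octahedral.triple[OF perm_dabc h L(1,2,3) 11]) (use caps in \<open>simp_all add: cap_def\<close>)
  next
    case 12 show False
      by (rule octahedral.triple[OF perm_cabd h L(1,2,4) 12]) (use caps in \<open>simp_all add: cap_def\<close>)
  next
    case 13 show False
      by (rule octahedral.triple[OF perm_bacd h L(1,3,4) 13]) (use caps in \<open>simp_all add: cap_def\<close>)
  next
    case 14 then show False using triple[OF h L(2,3,4)] caps by blast
  next
    case 15 then show False using quadruple[OF h L] caps by blast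
  qed
qed

end

section \<open>From lattices in three-space to the facet functionals\<close>

text \<open>Four vectors of a three-dimensional space over the field with two elements are
  dependent. A boolean means "this coordinate is even", so addition of coordinates becomes equality
  of booleans, and each disjunct says that one nonempty partial sum vanishes.\<close>

lemma parity_dependence:
  fixes i1 i2 i3 i4 j1 j2 j3 j4 k1 k2 k3 k4 :: bool
  shows "(i1 \<and> j1 \<and> k1) \<or> (i2 \<and> j2 \<and> k2) \<or> (i3 \<and> j3 \<and> k3) \<or> (i4 \<and> j4 \<and> k4)
   \<or> ((i1 = i2) \<and> (j1 = j2) \<and> (k1 = k2)) \<or> ((i1 = i3) \<and> (j1 = j3) \<and> (k1 = k3)) \<or> ((i1 = i4) \<and> (j1 = j4) \<and> (k1 = k4))
   \<or> ((i2 = i3) \<and> (j2 = j3) \<and> (k2 = k3)) \<or> ((i2 = i4) \<and> (j2 = j4) \<and> (k2 = k4)) \<or> ((i3 = i4) \<and> (j3 = j4) \<and> (k3 = k4))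
   \<or> ((i1 = i2) = i3 \<and> (j1 = j2) = j3 \<and> (k1 = k2) = k3) \<or> ((i1 = i2) = i4 \<and> (j1 = j2) = j4 \<and> (k1 = k2) = k4)
   \<or> ((i1 = i3) = i4 \<and> (j1 = j3) = j4 \<and> (k1 = k3) = k4) \<or> ((i2 = i3) = i4 \<and> (j2 = j3) = j4 \<and> (k2 = k3) = k4)
   \<or> (((i1 = i2) = i3) = i4 \<and> ((j1 = j2) = j3) = j4 \<and> ((k1 = k2) = k3) = k4)"
  by argo

lemma octahedral_lattice:
  assumes L: "is_lattice L" and packing: "is_packing octahedron L"
    and covering: "is_covering ((*\<^sub>R) r ` octahedron) L" and r: "0 < r" "r < 7/6"
  shows "octahedral L (\<lambda>x. x $ 1 + x $ 2 + x $ 3) (\<lambda>x. x $ 1 - x $ 2 - x $ 3)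
    (\<lambda>x. - x $ 1 + x $ 2 - x $ 3) (\<lambda>x. - x $ 1 - x $ 2 + x $ 3)"
    (is "octahedral L ?a ?b ?c ?d")
proof -
  obtain x y z where xyz: "L = {of_int i *\<^sub>R x + of_int j *\<^sub>R y + of_int k *\<^sub>R z | i j k. True}"
    using lattice_coordinates[OF L] by blast
  define V where "V i j k = of_int i *\<^sub>R x + of_int j *\<^sub>R y + of_int k *\<^sub>R z" for i j k
  have V_L: "V i j k \<in> L" for i j k
    by (auto simp: xyz V_def)
  have L_V: "\<exists>i j k. v = V i j k" if "v \<in> L" for v
    using that by (auto simp: xyz V_def)
  have V_add: "V i j k + V i' j' k' = V (i + i') (j + j') (k + k')" for i j k i' j' k'
    by (simp add: V_def algebra_simps)
  have V_diff: "V i j k - V i' j' k' = V (i - i') (j - j') (k - k')" for i j k i' j' k'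
    by (simp add: V_def algebra_simps)
  have half: "\<exists>h\<in>L. h + h = V i j k" if "even i \<and> even j \<and> even k" for i j k
  proof -
    from that obtain i' j' k' where "i = i' + i'" "j = j' + j'" "k = k' + k'"
      unfolding dvd_def by (metis mult_2)
    then show ?thesis by (metis V_L V_add)
  qed
  show ?thesis
  proof (rule octahedral.intro)
    fix v assume "v \<in> L" and less: "\<bar>?a v\<bar> < 2" "\<bar>?b v\<bar> < 2" "\<bar>?c v\<bar> < 2" "\<bar>?d v\<bar> < 2"
    have "0 \<in> L" using V_L[of 0 0 0] by (simp add: V_def)
    moreover have "l1 (v - 0) < 2" using less unfolding l1_def by simp
    ultimately show "v = 0"
      using packing \<open>v \<in> L\<close> unfolding packing_octahedron_iff by force
  next
    fix p q s t :: real assume sum: "p + q + s + t = 0"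
    \<comment> \<open>The functionals satisfy a + b = 2 x1, a + c = 2 x2, a + d = 2 x3. Since p, q,
      s, t sum to zero, this point takes exactly these values.\<close>
    define x :: "real ^ 3" where "x = vector [(p + q) / 2, (p + s) / 2, (p + t) / 2 :: real]"
    have x: "x $ 1 = (p + q) / 2" "x $ 2 = (p + s) / 2" "x $ 3 = (p + t) / 2"
      by (simp_all add: x_def)
    obtain v where v: "v \<in> L" "l1 (x - v) \<le> r"
      using covering covering_octahedron_iff[OF r(1)] by blast
    have "\<bar>(p + q) / 2 - v $ 1\<bar> + \<bar>(p + s) / 2 - v $ 2\<bar> + \<bar>(p + t) / 2 - v $ 3\<bar> < 7/6"
      using v(2) r(2) by (simp add: l1_def x)
    then show "\<exists>v\<in>L. \<bar>p - ?a v\<bar> < 7/6 \<and> \<bar>q - ?b v\<bar> < 7/6 \<and> \<bar>s - ?c v\<bar> < 7/6 \<and> \<bar>t - ?d v\<bar> < 7/6"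
      using sum v(1) by (intro bexI[of _ v] conjI; argo)
  next
    fix t u v w assume "{t, u, v, w} \<subseteq> L"
    then obtain i1 j1 k1 i2 j2 k2 i3 j3 k3 i4 j4 k4
      where *: "t = V i1 j1 k1" "u = V i2 j2 k2" "v = V i3 j3 k3" "w = V i4 j4 k4"
      using L_V by (metis insert_subset)
    show "\<exists>h\<in>L. h + h \<in> {t, u, v, w, t + u, t + v, t + w, u + v, u + w, v + w,
        t + u + v, t + u + w, t + v + w, u + v + w, t + u + v + w}"
      using parity_dependence[of "even i1" "even j1" "even k1" "even i2" "even j2" "even k2"
          "even i3" "even j3" "even k3" "even i4" "even j4" "even k4"]
      unfolding even_add[symmetric] * V_add by (elim disjE) (drule half, elim bexE, erule bexI[rotated], simp)+
  next
    show "u - v \<in> L" if "u \<in> L" "v \<in> L" for u v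
      using that L_V V_L V_diff by metis
  qed (auto intro!: linearI simp: algebra_simps)
qed

section \<open>The optimal lattice\<close>

text \<open>After scaling by 3 the covering radius is 7/2 and the lattice has index 38 in the
  integer points, so a unit cube of the integer grid is determined up to lattice translations by the
  residue \<open>m\<close> of its lowest corner. For eight residues a corner of the cube is a
  lattice point, and 3 suffices as radius. In the other cases two or four lattice points are listed
  whose distance functions on the cube are affine with cancelling gradients. Two distances add up to
  6. Four, for the residues 2, 5, 14, 17, 22 and 35, add up to exactly 14, four times 7/2.\<close>

lemma unit_cube_cover:
  fixes x y z :: real and m :: int
  assumes xyz: "0 \<le> x" "x \<le> 1" "0 \<le> y" "y \<le> 1" "0 \<le> z" "z \<le> 1" and m: "0 \<le> m" "m < 38"
  shows "\<exists>u v w. 38 dvd m + u + 7 * v + 11 * w \<and> \<bar>x - of_int u\<bar> + \<bar>y - of_int v\<bar> + \<bar>z - of_int w\<bar> \<le> 7/2"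
proof (rule ccontr)
  assume far: "\<not> ?thesis"
  \<comment> \<open>On the interval from 0 to 1 the distance to an integer is affine, with a sign
    that depends only on that integer. For concrete integers \<open>g\<close> evaluates to this
    affine form, so the cases below are purely linear.\<close>
  define g :: "real \<Rightarrow> int \<Rightarrow> real" where "g s i = (if i \<ge> 1 then of_int i - s else s - of_int i)" for s i
  have g: "\<bar>s - of_int i\<bar> = g s i" if "0 \<le> s" "s \<le> 1" for s i
  proof (cases "1 \<le> i")
    case True
    then have "1 \<le> real_of_int i" by simp
    with that show ?thesis by (simp add: g_def)
  next
    case False
    then have "real_of_int i \<le> 0" by simp
    with that False show ?thesis by (simp add: g_def)
  qed
  have far: "7/2 < g x u + g y v + g z w" if "38 dvd m + u + 7 * v + 11 * w" for u v w
    using far that xyz by (auto simp: g not_le)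
  note g_def [simp]
  have "m = 0 \<or> m = 1 \<or> m = 2 \<or> m = 3 \<or> m = 4 \<or> m = 5 \<or> m = 6 \<or> m = 7 \<or> m = 8 \<or> m = 9 \<or> m = 10 \<or> m = 11 \<or> m = 12 \<or> m = 13 \<or> m = 14 \<or> m = 15 \<or> m = 16 \<or> m = 17 \<or> m = 18 \<or> m = 19 \<or> m = 20 \<or> m = 21 \<or> m = 22 \<or> m = 23 \<or> m = 24 \<or> m = 25 \<or> m = 26 \<or> m = 27 \<or> m = 28 \<or> m = 29 \<or> m = 30 \<or> m = 31 \<or> m = 32 \<or> m = 33 \<or> m = 34 \<or> m = 35 \<or> m = 36 \<or> m = 37"
    using m by presburger
  then consider "m = 0" | "m = 1" | "m = 2" | "m = 3" | "m = 4" | "m = 5" | "m = 6" | "m = 7" | "m = 8" | "m = 9" | "m = 10" | "m = 11" | "m = 12" | "m = 13" | "m = 14" | "m = 15" | "m = 16" | "m = 17" | "m = 18" | "m = 19" | "m = 20" | "m = 21" | "m = 22" | "m = 23" | "m = 24" | "m = 25" | "m = 26" | "m = 27" | "m = 28" | "m = 29" | "m = 30" | "m = 31" | "m = 32" | "m = 33" | "m = 34" | "m = 35" | "m = 36" | "m = 37"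
    by (elim disjE) (erule that)+
  then show False
  proof cases
    case 1 with xyz show False using far[of 0 0 0] by simp
  next
    case 2 with xyz show False using far[of "-1" 0 0] far[of 1 2 2] by simp
  next
    case 3 with xyz show False using far[of "-2" 0 0] far[of 0 2 2] far[of 1 "-2" 1] far[of 2 1 "-1"] by simp
  next
    case 4 with xyz show False using far[of 0 "-2" 1] far[of 1 1 "-1"] by simp
  next
    case 5 with xyz show False using far[of 0 1 "-1"] far[of 1 0 3] by simp
  next
    case 6 with xyz show False using far[of "-1" 1 "-1"] far[of 0 0 3] far[of 1 3 1] far[of 2 "-1" 0] by simp
  next
    case 7 with xyz show False using far[of 0 3 1] far[of 1 "-1" 0] by simp
  next
    case 8 with xyz show False using far[of 0 "-1" 0] far[of 2 1 2] by simp
  next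
    case 9 with xyz show False using far[of "-1" "-1" 0] far[of 1 1 2] by simp
  next
    case 10 with xyz show False using far[of 0 1 2] far[of 2 0 "-1"] by simp
  next
    case 11 with xyz show False using far[of "-1" 1 2] far[of 1 0 "-1"] by simp
  next
    case 12 with xyz show False using far[of 0 0 "-1"] far[of 2 2 1] by simp
  next
    case 13 with xyz show False using far[of "-1" 0 "-1"] far[of 1 2 1] by simp
  next
    case 14 with xyz show False using far[of 0 2 1] far[of 1 "-2" 0] by simp
  next
    case 15 with xyz show False using far[of "-1" 2 1] far[of 0 "-2" 0] far[of 1 1 "-2"] far[of 2 0 2] by simp
  next
    case 16 with xyz show False using far[of 0 1 "-2"] far[of 1 0 2] by simp
  next
    case 17 with xyz show False using far[of 0 0 2] far[of 1 3 0] by simp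
  next
    case 18 with xyz show False using far[of "-1" 0 2] far[of 0 3 0] far[of 1 "-1" "-1"] far[of 3 1 1] by simp
  next
    case 19 with xyz show False using far[of 0 "-1" "-1"] far[of 2 1 1] by simp
  next
    case 20 with xyz show False using far[of 1 1 1] by simp
  next
    case 21 with xyz show False using far[of 0 1 1] by simp
  next
    case 22 with xyz show False using far[of "-1" 1 1] far[of 1 0 "-2"] by simp
  next
    case 23 with xyz show False using far[of "-2" 1 1] far[of 0 0 "-2"] far[of 1 "-1" 2] far[of 2 2 0] by simp
  next
    case 24 with xyz show False using far[of 0 "-1" 2] far[of 1 2 0] by simp
  next
    case 25 with xyz show False using far[of 0 2 0] far[of 3 0 1] by simp
  next
    case 26 with xyz show False using far[of "-1" 2 0] far[of 2 0 1] by simp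
  next
    case 27 with xyz show False using far[of 1 0 1] by simp
  next
    case 28 with xyz show False using far[of 0 0 1] by simp
  next
    case 29 with xyz show False using far[of "-1" 0 1] far[of 3 1 0] by simp
  next
    case 30 with xyz show False using far[of "-2" 0 1] far[of 2 1 0] by simp
  next
    case 31 with xyz show False using far[of 1 1 0] by simp
  next
    case 32 with xyz show False using far[of 0 1 0] by simp
  next
    case 33 with xyz show False using far[of "-1" 1 0] far[of 2 "-1" 1] by simp
  next
    case 34 with xyz show False using far[of "-2" 1 0] far[of 1 "-1" 1] by simp
  next
    case 35 with xyz show False using far[of 0 "-1" 1] far[of 1 2 "-1"] by simp
  next
    case 36 with xyz show False using far[of "-1" "-1" 1] far[of 0 2 "-1"] far[of 1 1 3] far[of 3 0 0] by simp
  next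
    case 37 with xyz show False using far[of 0 1 3] far[of 2 0 0] by simp
  next
    case 38 with xyz show False using far[of 1 0 0] by simp
  qed
qed

section \<open>The lattice itself: basis, packing and covering\<close>

definition u1 :: "real ^ 3" where "u1 = vector [1, -2/3, 1/3]"
definition u2 :: "real ^ 3" where "u2 = vector [1/3, 1, -2/3]"
definition u3 :: "real ^ 3" where "u3 = vector [-2/3, 1/3, 1]"

definition optimal_lattice :: "(real ^ 3) set" where
  "optimal_lattice = range (\<lambda>c :: real ^ 3 \<Rightarrow> int. \<Sum>b\<in>{u1, u2, u3}. of_int (c b) *\<^sub>R b)"

lemma u_nth [simp]:
  "u1 $ 1 = 1" "u1 $ 2 = -2/3" "u1 $ 3 = 1/3"
  "u2 $ 1 = 1/3" "u2 $ 2 = 1" "u2 $ 3 = -2/3"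
  "u3 $ 1 = -2/3" "u3 $ 2 = 1/3" "u3 $ 3 = 1"
  by (simp_all add: u1_def u2_def u3_def)

lemma u_distinct: "u1 \<noteq> u2" "u1 \<noteq> u3" "u2 \<noteq> u3"
  by (auto dest!: arg_cong[of _ _ "\<lambda>v. v $ 1"])

lemma is_lattice_optimal: "is_lattice optimal_lattice"
proof -
  have "x \<in> span {u1, u2, u3}" for x
  proof -
    have "x = ((33 * x $ 1 + 3 * x $ 2 + 21 * x $ 3) / 38) *\<^sub>R u1
      + ((21 * x $ 1 + 33 * x $ 2 + 3 * x $ 3) / 38) *\<^sub>R u2
      + ((3 * x $ 1 + 21 * x $ 2 + 33 * x $ 3) / 38) *\<^sub>R u3"
      by (simp add: vec_eq_iff forall_3 field_simps)
    then show ?thesis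
      by (metis insertCI span_add span_base span_scale)
  qed
  then have span: "span {u1, u2, u3} = UNIV" by blast
  moreover have "independent {u1, u2, u3}"
    by (rule card_le_dim_spanning[of _ UNIV]) (use span u_distinct in \<open>auto simp: dim_UNIV\<close>)
  ultimately show ?thesis
    unfolding is_lattice_def optimal_lattice_def by blast
qed

lemma mem_optimal_lattice:
  "v \<in> optimal_lattice \<longleftrightarrow> (\<exists>i j k :: int. v $ 1 = of_int (3 * i + j - 2 * k) / 3 \<and>
     v $ 2 = of_int (- 2 * i + 3 * j + k) / 3 \<and> v $ 3 = of_int (i - 2 * j + 3 * k) / 3)"
  (is "_ \<longleftrightarrow> ?R")
proof
  assume "v \<in> optimal_lattice"
  then obtain c where "v = of_int (c u1) *\<^sub>R u1 + (of_int (c u2) *\<^sub>R u2 + of_int (c u3) *\<^sub>R u3)"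
    using u_distinct by (auto simp: optimal_lattice_def)
  then show ?R
    by (intro exI[of _ "c u1"] exI[of _ "c u2"] exI[of _ "c u3"]) (simp add: field_simps)
next
  assume ?R
  then obtain i j k :: int where "v $ 1 = of_int (3 * i + j - 2 * k) / 3"
     "v $ 2 = of_int (- 2 * i + 3 * j + k) / 3" "v $ 3 = of_int (i - 2 * j + 3 * k) / 3"
    by blast
  then have "v = of_int i *\<^sub>R u1 + (of_int j *\<^sub>R u2 + of_int k *\<^sub>R u3)"
    by (simp add: vec_eq_iff forall_3 field_simps)
  then show "v \<in> optimal_lattice"
    unfolding optimal_lattice_def using u_distinct
    by (intro range_eqI[of _ _ "\<lambda>b. if b = u1 then i else if b = u2 then j else k"]) auto
qed

lemma packing_optimal: "is_packing octahedron optimal_lattice"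
  unfolding packing_octahedron_iff
proof (intro ballI impI)
  fix v w assume "v \<in> optimal_lattice" "w \<in> optimal_lattice" "v \<noteq> w"
  then obtain i j k i' j' k' :: int where v: "v $ 1 = of_int (3 * i + j - 2 * k) / 3"
     "v $ 2 = of_int (- 2 * i + 3 * j + k) / 3" "v $ 3 = of_int (i - 2 * j + 3 * k) / 3"
    and w: "w $ 1 = of_int (3 * i' + j' - 2 * k') / 3"
     "w $ 2 = of_int (- 2 * i' + 3 * j' + k') / 3" "w $ 3 = of_int (i' - 2 * j' + 3 * k') / 3"
    unfolding mem_optimal_lattice by blast
  define r s t where rst: "r = i - i'" "s = j - j'" "t = k - k'"
  have "\<not> (r = 0 \<and> s = 0 \<and> t = 0)"
    using \<open>v \<noteq> w\<close> v w by (auto simp: rst vec_eq_iff forall_3)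
  have "6 \<le> \<bar>3 * r + s - 2 * t\<bar> + \<bar>- 2 * r + 3 * s + t\<bar> + \<bar>r - 2 * s + 3 * t\<bar>"
  proof (rule ccontr)
    assume small: "\<not> ?thesis"
    define X Y Z where XYZ: "X = 3 * r + s - 2 * t" "Y = - 2 * r + 3 * s + t" "Z = r - 2 * s + 3 * t"
    \<comment> \<open>The inverse of the integer basis matrix, which has determinant 38. Norm at
      most 5 gives \<open>38 * \<bar>r\<bar> \<le> 55\<close>, and likewise for \<open>s\<close> and
      \<open>t\<close>, so only coefficients -1, 0, 1 remain to be checked.\<close>
    have "38 * r = 11 * X + Y + 7 * Z" "38 * s = 7 * X + 11 * Y + Z" "38 * t = X + 7 * Y + 11 * Z"
      by (simp_all add: XYZ)
    moreover have "\<bar>X\<bar> + \<bar>Y\<bar> + \<bar>Z\<bar> \<le> 5" using small by (simp add: XYZ)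
    ultimately have "\<bar>r\<bar> \<le> 1" "\<bar>s\<bar> \<le> 1" "\<bar>t\<bar> \<le> 1"
      by linarith+
    then have "r = -1 \<or> r = 0 \<or> r = 1" "s = -1 \<or> s = 0 \<or> s = 1" "t = -1 \<or> t = 0 \<or> t = 1"
      by linarith+
    with small \<open>\<not> (r = 0 \<and> s = 0 \<and> t = 0)\<close> show False
      by (elim disjE) simp_all
  qed
  then have "real_of_int 6 \<le> of_int (\<bar>3 * r + s - 2 * t\<bar> + \<bar>- 2 * r + 3 * s + t\<bar> + \<bar>r - 2 * s + 3 * t\<bar>)"
    by (simp only: of_int_le_iff)
  also have "\<dots> = 3 * l1 (v - w)"
  proof -
    have scale: "of_int \<bar>n\<bar> = 3 * \<bar>x\<bar>" if "3 * x = of_int n" for x :: real and n :: int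
    proof -
      have "of_int \<bar>n\<bar> = \<bar>3 * x\<bar>" using that by simp
      then show ?thesis by (simp add: abs_mult)
    qed
    have *: "3 * (v $ 1 - w $ 1) = of_int (3 * r + s - 2 * t)" "3 * (v $ 2 - w $ 2) = of_int (- 2 * r + 3 * s + t)"
      "3 * (v $ 3 - w $ 3) = of_int (r - 2 * s + 3 * t)"
      by (simp_all add: v w rst field_simps)
    show ?thesis
      unfolding of_int_add scale[OF *(1)] scale[OF *(2)] scale[OF *(3)] l1_def by simp
  qed
  finally show "2 \<le> l1 (v - w)" by simp
qed

lemma covering_optimal: "is_covering ((*\<^sub>R) (7/6) ` octahedron) optimal_lattice"
proof -
  have "\<exists>v\<in>optimal_lattice. l1 (p - v) \<le> 7/6" for p
  proof -
    define X Y Z where XYZ: "X = \<lfloor>3 * p $ 1\<rfloor>" "Y = \<lfloor>3 * p $ 2\<rfloor>" "Z = \<lfloor>3 * p $ 3\<rfloor>"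
    define m where "m = (X + 7 * Y + 11 * Z) mod 38"
    have "0 \<le> 3 * p $ 1 - X" "3 * p $ 1 - X \<le> 1" "0 \<le> 3 * p $ 2 - Y" "3 * p $ 2 - Y \<le> 1"
      "0 \<le> 3 * p $ 3 - Z" "3 * p $ 3 - Z \<le> 1" "0 \<le> m" "m < 38"
      unfolding XYZ m_def by (linarith | simp)+
    from unit_cube_cover[OF this] obtain u v w where dvd: "38 dvd m + u + 7 * v + 11 * w"
      and near: "\<bar>3 * p $ 1 - X - u\<bar> + \<bar>3 * p $ 2 - Y - v\<bar> + \<bar>3 * p $ 3 - Z - w\<bar> \<le> 7/2"
      by blast
    define U V W where UVW: "U = X + u" "V = Y + v" "W = Z + w"
    define n where "n = (X + 7 * Y + 11 * Z) div 38"
    have "X + 7 * Y + 11 * Z = 38 * n + m"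
      by (simp add: m_def n_def)
    then have "U + 7 * V + 11 * W = (m + u + 7 * v + 11 * w) + 38 * n"
      unfolding UVW by algebra
    with dvd have "38 dvd U + 7 * V + 11 * W"
      by simp
    then obtain k where k: "U + 7 * V + 11 * W = 38 * k" by blast
    \<comment> \<open>The inverse matrix again: \<open>k\<close> is already its third row applied to
      U, V, W, and substituting \<open>U = 38 * k - 7 * V - 11 * W\<close> into the rows (11, 1, 7)
      and (7, 11, 1) makes them divisible by 38.\<close>
    define i j where ij: "i = 11 * k - 2 * V - 3 * W" "j = 7 * k - V - 2 * W"
    have UVW': "U = 3 * i + j - 2 * k" "V = - 2 * i + 3 * j + k" "W = i - 2 * j + 3 * k"
      using k by (simp_all add: ij)
    define q :: "real ^ 3" where "q = vector [U / 3, V / 3, W / 3]"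
    have q: "q $ 1 = U / 3" "q $ 2 = V / 3" "q $ 3 = W / 3"
      by (simp_all add: q_def)
    have "q \<in> optimal_lattice"
      unfolding mem_optimal_lattice q
      by (rule exI[of _ i], rule exI[of _ j], rule exI[of _ k]) (simp only: UVW')
    moreover have "3 * l1 (p - q) \<le> 7/2"
    proof -
      have "3 * \<bar>x - n / 3\<bar> = \<bar>3 * x - n\<bar>" for x n :: real
        by (simp add: abs_if field_simps)
      then have "3 * l1 (p - q) = \<bar>3 * p $ 1 - U\<bar> + \<bar>3 * p $ 2 - V\<bar> + \<bar>3 * p $ 3 - W\<bar>"
        by (simp add: l1_def q distrib_left)
      with near show ?thesis by (simp add: UVW diff_diff_eq)
    qed
    ultimately show ?thesis by (intro bexI[of _ q]) simp_all
  qed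
  then show ?thesis by (simp add: covering_octahedron_iff)
qed

theorem theorem1:
  shows "gamma_star octahedron = 7 / 6 \<and>
    (\<exists>L. is_lattice L \<and> is_packing octahedron L \<and>
         is_covering ((*\<^sub>R) (7 / 6) ` octahedron) L) \<and>
    (\<forall>r>0. (\<exists>L. is_lattice L \<and> is_packing octahedron L \<and>
                is_covering ((*\<^sub>R) r ` octahedron) L) \<longrightarrow> 7 / 6 \<le> r)"
proof -
  let ?P = "\<lambda>r. \<exists>L. is_lattice L \<and> is_packing octahedron L \<and> is_covering ((*\<^sub>R) r ` octahedron) L"
  have upper: "?P (7/6)"
    using is_lattice_optimal packing_optimal covering_optimal by blast
  have lower: "7/6 \<le> r" if r: "0 < r" and P: "?P r" for r
  proof (rule ccontr)
    assume "\<not> 7/6 \<le> r"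
    then have "r < 7/6" by simp
    with P r show False
      using octahedral.contradiction[OF octahedral_lattice] by blast
  qed
  have "gamma_star octahedron = 7/6"
    unfolding gamma_star_def by (rule Least_equality) (use upper lower in auto)
  with upper lower show ?thesis by blast
qed

end
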